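(* Let $G$ be a finite simple connected graph with at least one edge and let $n\ge 2$ be an integer. Then the ideal $I(G)^n$ is Lyubeznik (i.e., admits a minimal Lyubeznik resolution) if and only if one of the following holds: (1) $G$ is an edge (two vertices joined by an edge); or (2) $n=2$ and $G$ is a path of length $2$ (three vertices, two edges).
   Context: Let $\Bbbk$ be a field. For a graph $G=(V,E)$ let $S=\Bbbk[V]$ be the polynomial ring whose variables are the vertices of $G$; the edge ideal is $I(G)=\langle xy : \{x,y\}\in E\rangle\subseteq S$. Lyubeznik ideals. For a monomial ideal $I\subseteq S$ let $\mathrm{Gens}(I)$ be its set of minimal monomial generators. Fix a total order $(\succ)$ on $\mathrm{Gens}(I)$. A subset $\sigma=\{m_1\succ\cdots\succ m_k\}$ of $\mathrm{Gens}(I)$ is Lyubeznik-critical if there is no $m\in\mathrm{Gens}(I)$ and no $t$ with $1<t\le k$ such that $m_t\succ m$ and $m\mid\mathrm{lcm}(m_1,\dots,m_t)$. The Lyubeznik resolution of $S/I$ with respect to $(\succ)$ is the subcomplex of the Taylor resolution whose $i$-th module has as basis the Lyubeznik-critical subsets with exactly $i$ elements, with differential $\partial(\sigma)=\sum_{\tau\subseteq\sigma,\,|\tau|=|\sigma|-1}\pm\frac{\mathrm{lcm}(\sigma)}{\mathrm{lcm}(\tau)}\tau$ (Taylor signs); it is a free resolution of $S/I$. It is minimal if the image of $\partial$ lies in the ideal of variables times the complex; equivalently, if no Lyubeznik-critical $\sigma$ contains an element $m$ with $\mathrm{lcm}(\sigma\setminus\{m\})=\mathrm{lcm}(\sigma)$.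 The ideal $I$ is called Lyubeznik if for some total order on $\mathrm{Gens}(I)$ the corresponding Lyubeznik resolution is minimal. *)

theory Defs
  imports
    "HOL-Library.Multiset"
    "HOL-Library.Poly_Mapping"
    "HOL-Algebra.Ideal_Product"
begin

section \<open>Polynomial rings\<close>

text \<open>
  Monomials are multisets of variables: multiplication is \<open>+\<close>, divisibility is \<open>\<subseteq>#\<close>, the lcm of a
  finite set of monomials is \<open>Sup\<close>, and, for \<open>a \<subseteq># b\<close>, the quotient \<open>b / a\<close> is \<open>b - a\<close>.
  Polynomials are finitely supported functions from monomials to coefficients, with the
  convolution product of \<open>Poly_Mapping\<close>.
\<close>

type_synonym ('v, 'k) mpoly = "'v multiset \<Rightarrow>\<^sub>0 'k"

definition monomial :: "'v multiset \<Rightarrow> ('v, 'k::field) mpoly" where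
  "monomial m = Poly_Mapping.single m 1"

definition poly_ring :: "'v set \<Rightarrow> ('v, 'k::field) mpoly ring" where
  "poly_ring V =
     \<lparr>carrier = {p. \<forall>m \<in> Poly_Mapping.keys p. set_mset m \<subseteq> V},
      mult = (*), one = 1, zero = 0, add = (+)\<rparr>"

lemma cring_poly_ring: "cring (poly_ring V :: ('v, 'k::field) mpoly ring)"
proof (intro cringI abelian_groupI comm_monoidI)
  fix p q :: "('v, 'k) mpoly"
  assume p: "p \<in> carrier (poly_ring V)" and q: "q \<in> carrier (poly_ring V)"
  show "p \<oplus>\<^bsub>poly_ring V\<^esub> q \<in> carrier (poly_ring V)"
    using p q Poly_Mapping.keys_add[of p q] by (auto simp: poly_ring_def)
  show "p \<otimes>\<^bsub>poly_ring V\<^esub> q \<in> carrier (poly_ring V)"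
  proof -
    have "set_mset m \<subseteq> V" if m: "m \<in> Poly_Mapping.keys (p * q)" for m
    proof -
      obtain a b where "m = a + b" "a \<in> Poly_Mapping.keys p" "b \<in> Poly_Mapping.keys q"
        using m keys_mult[of p q] by blast
      then show ?thesis using p q by (auto simp: poly_ring_def)
    qed
    then show ?thesis by (simp add: poly_ring_def)
  qed
  show "\<exists>r\<in>carrier (poly_ring V). r \<oplus>\<^bsub>poly_ring V\<^esub> p = \<zero>\<^bsub>poly_ring V\<^esub>"
    using p by (intro bexI[of _ "- p"]) (auto simp: poly_ring_def)
qed (auto simp: poly_ring_def algebra_simps)

section \<open>Lyubeznik ideals\<close>

definition gens :: "('v, 'k::field) mpoly set \<Rightarrow> 'v multiset set" where
  "gens I = {m. monomial m \<in> I \<and> (\<forall>m'. monomial m' \<in> I \<and> m' \<subseteq># m \<longrightarrow> m' = m)}"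

text \<open>
  Total orders are reflexive relations \<open>r\<close> in which \<open>(u, v) \<in> r\<close> means \<open>u \<succeq> v\<close>.  Writing
  \<open>\<sigma> = {m\<^sub>1 \<succ> \<dots> \<succ> m\<^sub>k}\<close> and \<open>p = m\<^sub>t\<close>, the set \<open>{u \<in> \<sigma>. (u, p) \<in> r}\<close> is \<open>{m\<^sub>1, \<dots>, m\<^sub>t}\<close> and
  its cardinality is \<open>t\<close>.
\<close>

definition lyubeznik_critical ::
  "('v, 'k::field) mpoly set \<Rightarrow> 'v multiset rel \<Rightarrow> 'v multiset set \<Rightarrow> bool" where
  "lyubeznik_critical I r \<sigma> \<longleftrightarrow>
     \<sigma> \<subseteq> gens I \<and>
     \<not> (\<exists>m \<in> gens I. \<exists>p \<in> \<sigma>.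
          1 < card {u \<in> \<sigma>. (u, p) \<in> r} \<and> (p, m) \<in> r \<and> p \<noteq> m \<and>
          m \<subseteq># Sup {u \<in> \<sigma>. (u, p) \<in> r})"

text \<open>
  Elements of a free module with basis a family of sets of monomials are represented by their
  finitely supported coefficient functions.
\<close>

definition lyubeznik_module ::
  "'v set \<Rightarrow> ('v, 'k::field) mpoly set \<Rightarrow> 'v multiset rel \<Rightarrow> nat
    \<Rightarrow> ('v multiset set \<Rightarrow>\<^sub>0 ('v, 'k) mpoly) set" where
  "lyubeznik_module V I r i =
     {f. (\<forall>\<sigma> \<in> Poly_Mapping.keys f. lyubeznik_critical I r \<sigma> \<and> card \<sigma> = i) \<and>
         (\<forall>\<sigma>. Poly_Mapping.lookup f \<sigma> \<in> carrier (poly_ring V))}"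

text \<open>
  The Taylor differential, extended linearly from the basis.  If \<open>m = m\<^sub>j\<close> in
  \<open>\<sigma> = {m\<^sub>1 \<succ> \<dots> \<succ> m\<^sub>k}\<close>, the sign of \<open>\<sigma> - {m}\<close> in the boundary of \<open>\<sigma>\<close> is \<open>(-1)\<close> to the
  power \<open>j - 1\<close>.
\<close>

definition taylor_diff ::
  "'v multiset rel \<Rightarrow> ('v multiset set \<Rightarrow>\<^sub>0 ('v, 'k::field) mpoly)
    \<Rightarrow> ('v multiset set \<Rightarrow>\<^sub>0 ('v, 'k) mpoly)" where
  "taylor_diff r f =
     (\<Sum>\<sigma> \<in> Poly_Mapping.keys f. \<Sum>m \<in> \<sigma>.
        Poly_Mapping.single (\<sigma> - {m})
          (Poly_Mapping.lookup f \<sigma> * (- 1) ^ card {u \<in> \<sigma>. (u, m) \<in> r \<and> u \<noteq> m} *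
           monomial (Sup \<sigma> - Sup (\<sigma> - {m}))))"

definition var_ideal :: "'v set \<Rightarrow> ('v, 'k::field) mpoly set" where
  "var_ideal V = Idl\<^bsub>poly_ring V\<^esub> {monomial {#v#} | v. v \<in> V}"

definition minimal_lyubeznik_resolution ::
  "'v set \<Rightarrow> ('v, 'k::field) mpoly set \<Rightarrow> 'v multiset rel \<Rightarrow> bool" where
  "minimal_lyubeznik_resolution V I r \<longleftrightarrow>
     (\<forall>i. taylor_diff r ` lyubeznik_module V I r (Suc i) \<subseteq>
            {g \<in> lyubeznik_module V I r i. \<forall>\<tau>. Poly_Mapping.lookup g \<tau> \<in> var_ideal V})"

text \<open>Intended for monomial ideals \<open>I\<close> of \<open>poly_ring V\<close> with \<open>V\<close> finite.\<close>

definition lyubeznik_ideal :: "'v set \<Rightarrow> ('v, 'k::field) mpoly set \<Rightarrow> bool" where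
  "lyubeznik_ideal V I \<longleftrightarrow>
     (\<exists>r. linear_order_on (gens I) r \<and> minimal_lyubeznik_resolution V I r)"

section \<open>Graphs and edge ideals\<close>

definition finite_simple_graph :: "'v set \<Rightarrow> 'v set set \<Rightarrow> bool" where
  "finite_simple_graph V E \<longleftrightarrow> finite V \<and> (\<forall>e \<in> E. e \<subseteq> V \<and> card e = 2)"

definition connected_graph :: "'v set \<Rightarrow> 'v set set \<Rightarrow> bool" where
  "connected_graph V E \<longleftrightarrow> (\<forall>u \<in> V. \<forall>v \<in> V. (u, v) \<in> {(x, y). {x, y} \<in> E}\<^sup>*)"

definition is_edge_graph :: "'v set \<Rightarrow> 'v set set \<Rightarrow> bool" where
  "is_edge_graph V E \<longleftrightarrow> (\<exists>a b. a \<noteq> b \<and> V = {a, b} \<and> E = {{a, b}})"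

definition is_path2_graph :: "'v set \<Rightarrow> 'v set set \<Rightarrow> bool" where
  "is_path2_graph V E \<longleftrightarrow>
     (\<exists>a b c. distinct [a, b, c] \<and> V = {a, b, c} \<and> E = {{a, b}, {b, c}})"

definition edge_ideal :: "'v set \<Rightarrow> 'v set set \<Rightarrow> ('v, 'k::field) mpoly set" where
  "edge_ideal V E = Idl\<^bsub>poly_ring V\<^esub> {monomial {#x, y#} | x y. {x, y} \<in> E}"

definition ideal_power :: "'v set \<Rightarrow> ('v, 'k::field) mpoly set \<Rightarrow> nat \<Rightarrow> ('v, 'k) mpoly set" where
  "ideal_power V I n = I [^]\<^bsub>ideals_set (poly_ring V)\<^esub> n"

end

theory Submission
  imports Defs
begin

text \<open>
  Every minimal generator of \<open>I(G)\<^sup>n\<close> is a product of \<open>n\<close> edges, and all such products are minimal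
  generators because they have the same degree \<open>2n\<close>.  The resolution is minimal if and only if no
  critical set has an element that can be removed without changing the lcm.  So the question is
  purely about divisibility among the products of \<open>n\<close> edges and total orders on them.

  To defeat all orders at once, look at the smallest element \<open>x\<close> of a suitable set \<open>B\<close> of generators.
  If \<open>y\<close> divides \<open>lcm(x, z)\<close>, then \<open>y\<close> is redundant in \<open>{x, y, z}\<close>, and criticality can
  only fail at a generator below \<open>x\<close> that divides \<open>lcm(x, z)\<close>, which the choice of \<open>x\<close> excludes when
  \<open>B\<close> contains the divisors of \<open>lcm(x, z)\<close>, or at a generator below both \<open>y\<close> and \<open>z\<close> that divides
  \<open>lcm(y, z)\<close>.  The latter is avoided if there are two candidates \<open>y\<^sub>1\<close>, \<open>y\<^sub>2\<close> for \<open>y\<close> such that the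
  generators dividing \<open>lcm(y\<^sub>1, z)\<close> or \<open>lcm(y\<^sub>2, z)\<close> are among \<open>z\<close>, \<open>y\<^sub>1\<close>, \<open>y\<^sub>2\<close>: take the
  smaller candidate.  This is the predicate \<open>obstructed\<close>, and \<open>obstructed_imp_redundant_critical\<close>
  is the argument.

  Four configurations of edges carry such triples \<open>z\<close>, \<open>y\<^sub>1\<close>, \<open>y\<^sub>2\<close> for each possible \<open>x\<close>: an induced
  path with two edges if \<open>n \<ge> 3\<close>, where the generators form a chain; a triangle; an induced claw
  if \<open>n = 2\<close>; and a path with three edges in a triangle-free graph, where four generators form a square.
  A connected graph with at least two edges contains one of them, unless \<open>n = 2\<close> and the graph is
  the path with two edges.

  Conversely, an edge has a single generator, and for the path with edges \<open>ab\<close> and \<open>bc\<close> the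
  generators of the square are \<open>a\<^sup>2b\<^sup>2\<close>, \<open>ab\<^sup>2c\<close> and \<open>b\<^sup>2c\<^sup>2\<close>; making the middle one the smallest
  prevents the outer two from lying together in a critical set.
\<close>

section \<open>Monomial ideals\<close>

definition monomial_ideal ::
  "'v set \<Rightarrow> 'v multiset set \<Rightarrow> ('v, 'k::field) mpoly set" where
  "monomial_ideal V A =
     {p \<in> carrier (poly_ring V). \<forall>m \<in> Poly_Mapping.keys p. \<exists>a\<in>A. a \<subseteq># m}"

lemma monomial_in_carrier_iff [simp]:
  "(monomial m :: ('v, 'k::field) mpoly) \<in> carrier (poly_ring V) \<longleftrightarrow> set_mset m \<subseteq> V"
  by (simp add: monomial_def poly_ring_def)

lemma monomial_in_monomial_ideal_iff:
  "(monomial m :: ('v, 'k::field) mpoly) \<in> monomial_ideal V A \<longleftrightarrow>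
     set_mset m \<subseteq> V \<and> (\<exists>a\<in>A. a \<subseteq># m)"
  unfolding monomial_ideal_def by (simp add: monomial_def poly_ring_def)

lemma a_inv_poly_ring:
  assumes "p \<in> carrier (poly_ring V)"
  shows "\<ominus>\<^bsub>poly_ring V\<^esub> p = - (p :: ('v, 'k::field) mpoly)"
proof -
  interpret R: cring "poly_ring V :: ('v, 'k) mpoly ring" by (rule cring_poly_ring)
  have "- p \<in> carrier (poly_ring V)" using assms by (simp add: poly_ring_def)
  moreover have "- p \<oplus>\<^bsub>poly_ring V\<^esub> p = \<zero>\<^bsub>poly_ring V\<^esub>" by (simp add: poly_ring_def)
  ultimately show ?thesis using assms R.minus_equality by blast
qed

lemma ideal_monomial_ideal:
  "ideal (monomial_ideal V A :: ('v, 'k::field) mpoly set) (poly_ring V)"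
proof -
  interpret R: cring "poly_ring V :: ('v, 'k) mpoly ring" by (rule cring_poly_ring)
  let ?I = "monomial_ideal V A :: ('v, 'k) mpoly set"
  have mult: "q * p \<in> ?I" if p: "p \<in> ?I" and q: "q \<in> carrier (poly_ring V)" for p q
  proof -
    have "q * p \<in> carrier (poly_ring V)"
      using R.m_closed[OF q, of p] p by (simp add: poly_ring_def monomial_ideal_def)
    moreover have "\<exists>a\<in>A. a \<subseteq># m" if m: "m \<in> Poly_Mapping.keys (q * p)" for m
    proof -
      obtain u w where "m = u + w" "w \<in> Poly_Mapping.keys p"
        using m keys_mult[of q p] by blast
      with p obtain a where "a \<in> A" "a \<subseteq># w" by (auto simp: monomial_ideal_def)
      with \<open>m = u + w\<close> show ?thesis
        by (metis mset_subset_eq_add_right subset_mset.order_trans)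
    qed
    ultimately show ?thesis by (simp add: monomial_ideal_def)
  qed
  show ?thesis
  proof (rule idealI)
    show "ring (poly_ring V :: ('v, 'k) mpoly ring)" by (rule R.ring_axioms)
    show "subgroup ?I (add_monoid (poly_ring V))"
    proof (rule R.add.subgroupI)
      show "?I \<subseteq> carrier (poly_ring V)" by (auto simp: monomial_ideal_def)
      have "0 \<in> ?I" by (simp add: monomial_ideal_def poly_ring_def)
      then show "?I \<noteq> {}" by blast
      show "\<ominus>\<^bsub>poly_ring V\<^esub> p \<in> ?I" if "p \<in> ?I" for p
        using that a_inv_poly_ring[of p V] by (auto simp: monomial_ideal_def poly_ring_def)
      show "p \<oplus>\<^bsub>poly_ring V\<^esub> q \<in> ?I" if "p \<in> ?I" "q \<in> ?I" for p q
      proof -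
        have "p \<oplus>\<^bsub>poly_ring V\<^esub> q \<in> carrier (poly_ring V)"
          using that by (auto simp: monomial_ideal_def)
        then show ?thesis
          using that Poly_Mapping.keys_add[of p q] by (auto simp: monomial_ideal_def poly_ring_def)
      qed
    qed
    show "q \<otimes>\<^bsub>poly_ring V\<^esub> p \<in> ?I" if "p \<in> ?I" "q \<in> carrier (poly_ring V)" for p q
      using mult[OF that] by (simp add: poly_ring_def)
    show "p \<otimes>\<^bsub>poly_ring V\<^esub> q \<in> ?I" if "p \<in> ?I" "q \<in> carrier (poly_ring V)" for p q
      using mult[OF that] by (simp add: poly_ring_def mult.commute)
  qed
qed

lemma
  assumes J: "ideal J (poly_ring V :: ('v, 'k::field) mpoly ring)"
  shows ideal_zero_closed: "0 \<in> J"
    and ideal_add_closed: "p \<in> J \<Longrightarrow> q \<in> J \<Longrightarrow> p + q \<in> J"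
    and ideal_mult_closed: "p \<in> carrier (poly_ring V) \<Longrightarrow> q \<in> J \<Longrightarrow> p * q \<in> J"
proof -
  interpret ideal J "poly_ring V :: ('v, 'k) mpoly ring" by (rule J)
  show "0 \<in> J" using additive_subgroup.zero_closed[OF ideal.axioms(1)[OF J]] by (simp add: poly_ring_def)
  show "p + q \<in> J" if "p \<in> J" "q \<in> J"
    using additive_subgroup.a_closed[OF ideal.axioms(1)[OF J] that] by (simp add: poly_ring_def)
  show "p * q \<in> J" if "p \<in> carrier (poly_ring V)" "q \<in> J"
    using I_l_closed[OF that(2,1)] by (simp add: poly_ring_def)
qed

lemma ideal_sum_closed:
  assumes J: "ideal J (poly_ring V :: ('v, 'k::field) mpoly ring)"
    and "\<And>i. i \<in> S \<Longrightarrow> f i \<in> J"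
  shows "(\<Sum>i\<in>S. f i) \<in> J"
  using assms(2)
  by (induction S rule: infinite_finite_induct)
    (simp_all add: ideal_zero_closed[OF J] ideal_add_closed[OF J])

lemma poly_mapping_sum_single:
  "(\<Sum>m\<in>Poly_Mapping.keys p. Poly_Mapping.single m (Poly_Mapping.lookup p m)) = p"
  by (rule poly_mapping_eqI) (auto simp: lookup_sum lookup_single when_def in_keys_iff)

text \<open>
  A polynomial is the sum of its terms, and each term of a member of the monomial ideal is a multiple
  of some monomial in \<open>A\<close>.  So an ideal that contains these monomials contains everything.  This
  gives the nontrivial inclusion both for generated ideals and for products of ideals.
\<close>

lemma monomial_ideal_subset:
  assumes J: "ideal J (poly_ring V :: ('v, 'k::field) mpoly ring)"
    and A: "\<And>a. a \<in> A \<Longrightarrow> set_mset a \<subseteq> V \<Longrightarrow> monomial a \<in> J"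
  shows "monomial_ideal V A \<subseteq> J"
proof
  fix p :: "('v, 'k) mpoly"
  assume p: "p \<in> monomial_ideal V A"
  have "Poly_Mapping.single m (Poly_Mapping.lookup p m) \<in> J"
    if m: "m \<in> Poly_Mapping.keys p" for m
  proof -
    from p m obtain a where a: "a \<in> A" "a \<subseteq># m" by (auto simp: monomial_ideal_def)
    have mV: "set_mset m \<subseteq> V" using p m by (auto simp: monomial_ideal_def poly_ring_def)
    then have "set_mset (m - a) \<subseteq> V" by (meson in_diffD subset_iff)
    then have "Poly_Mapping.single (m - a) (Poly_Mapping.lookup p m) \<in> carrier (poly_ring V)"
      by (simp add: poly_ring_def)
    moreover have "monomial a \<in> J"
      using A[OF a(1)] mV a(2) by (meson mset_subset_eqD subset_iff)
    ultimately have "Poly_Mapping.single (m - a) (Poly_Mapping.lookup p m) * monomial a \<in> J"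
      by (rule ideal_mult_closed[OF J])
    then show ?thesis using a(2) by (simp add: monomial_def mult_single)
  qed
  then have "(\<Sum>m\<in>Poly_Mapping.keys p. Poly_Mapping.single m (Poly_Mapping.lookup p m)) \<in> J"
    by (rule ideal_sum_closed[OF J])
  then show "p \<in> J" by (simp only: poly_mapping_sum_single)
qed

lemma genideal_monomials:
  assumes "\<And>a. a \<in> A \<Longrightarrow> set_mset a \<subseteq> V"
  shows "Idl\<^bsub>poly_ring V\<^esub> (monomial ` A) =
           (monomial_ideal V A :: ('v, 'k::field) mpoly set)"
proof -
  interpret R: cring "poly_ring V :: ('v, 'k) mpoly ring" by (rule cring_poly_ring)
  have sub: "(monomial ` A :: ('v, 'k) mpoly set) \<subseteq> carrier (poly_ring V)" using assms by auto
  show ?thesis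
  proof
    show "Idl\<^bsub>poly_ring V\<^esub> (monomial ` A) \<subseteq> (monomial_ideal V A :: ('v, 'k) mpoly set)"
      using assms by (intro R.genideal_minimal ideal_monomial_ideal)
        (auto simp: monomial_in_monomial_ideal_iff)
    show "monomial_ideal V A \<subseteq> (Idl\<^bsub>poly_ring V\<^esub> (monomial ` A) :: ('v, 'k) mpoly set)"
      using R.genideal_self[OF sub]
      by (intro monomial_ideal_subset R.genideal_ideal[OF sub]) auto
  qed
qed

lemma ideal_prod_monomial_ideals:
  "monomial_ideal V A \<cdot>\<^bsub>poly_ring V\<^esub> monomial_ideal V B =
     (monomial_ideal V {a + b | a b. a \<in> A \<and> b \<in> B} :: ('v, 'k::field) mpoly set)"
  (is "?I \<cdot>\<^bsub>_\<^esub> ?J = ?K")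
proof
  interpret R: cring "poly_ring V :: ('v, 'k) mpoly ring" by (rule cring_poly_ring)
  show "?I \<cdot>\<^bsub>poly_ring V\<^esub> ?J \<subseteq> ?K"
  proof
    fix s assume "s \<in> ?I \<cdot>\<^bsub>poly_ring V\<^esub> ?J"
    then show "s \<in> ?K"
    proof induction
      case (prod p q)
      then have "p \<otimes>\<^bsub>poly_ring V\<^esub> q \<in> carrier (poly_ring V)"
        by (intro R.m_closed) (simp_all add: monomial_ideal_def)
      moreover have "\<exists>c\<in>{a + b | a b. a \<in> A \<and> b \<in> B}. c \<subseteq># m"
        if m: "m \<in> Poly_Mapping.keys (p * q)" for m
      proof -
        obtain u w where "m = u + w" "u \<in> Poly_Mapping.keys p" "w \<in> Poly_Mapping.keys q"
          using subsetD[OF keys_mult m] by blast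
        moreover from this prod obtain a b where "a \<in> A" "a \<subseteq># u" "b \<in> B" "b \<subseteq># w"
          unfolding monomial_ideal_def by blast
        ultimately show ?thesis using subset_mset.add_mono by blast
      qed
      ultimately show ?case by (simp add: monomial_ideal_def poly_ring_def)
    next
      case (sum s t)
      have "s + t \<in> ?K" by (rule ideal_add_closed[OF ideal_monomial_ideal sum.IH])
      then show ?case by (simp add: poly_ring_def)
    qed
  qed
  show "?K \<subseteq> ?I \<cdot>\<^bsub>poly_ring V\<^esub> ?J"
  proof (rule monomial_ideal_subset)
    show "ideal (?I \<cdot>\<^bsub>poly_ring V\<^esub> ?J) (poly_ring V)"
      by (intro R.ideal_prod_is_ideal ideal_monomial_ideal)
    fix c assume "c \<in> {a + b | a b. a \<in> A \<and> b \<in> B}" "set_mset c \<subseteq> V"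
    then obtain a b where c: "c = a + b" "a \<in> A" "b \<in> B" "set_mset a \<subseteq> V" "set_mset b \<subseteq> V"
      by auto
    then have "(monomial a :: ('v, 'k) mpoly) \<in> ?I" "(monomial b :: ('v, 'k) mpoly) \<in> ?J"
      by (auto simp: monomial_in_monomial_ideal_iff)
    then have "monomial a \<otimes>\<^bsub>poly_ring V\<^esub> monomial b \<in> ?I \<cdot>\<^bsub>poly_ring V\<^esub> ?J"
      by (rule ideal_prod.prod)
    then show "monomial c \<in> ?I \<cdot>\<^bsub>poly_ring V\<^esub> ?J"
      by (simp add: c monomial_def poly_ring_def mult_single)
  qed
qed

text \<open>
  Monomials of equal degree divide each other only if they are equal, so nothing in \<open>A\<close> is superfluous.
\<close>

lemma gens_monomial_ideal:
  assumes "\<And>a. a \<in> A \<Longrightarrow> set_mset a \<subseteq> V \<and> size a = d"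
  shows "gens (monomial_ideal V A :: ('v, 'k::field) mpoly set) = A"
proof -
  have antichain: "b = a" if "a \<in> A" "b \<in> A" "b \<subseteq># a" for a b
    using that assms by (metis mset_subset_size order_less_irrefl subset_mset.le_imp_less_or_eq)
  show ?thesis
  proof
    show "A \<subseteq> gens (monomial_ideal V A :: ('v, 'k) mpoly set)"
    proof
      fix a assume a: "a \<in> A"
      have "m = a" if "b \<in> A" "b \<subseteq># m" "m \<subseteq># a" for b m
        using antichain[OF a that(1)] that by (metis subset_mset.order_antisym subset_mset.order_trans)
      then show "a \<in> gens (monomial_ideal V A :: ('v, 'k) mpoly set)"
        using a assms by (auto simp: gens_def monomial_in_monomial_ideal_iff)
    qed
    show "gens (monomial_ideal V A :: ('v, 'k) mpoly set) \<subseteq> A"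
    proof
      fix m assume m: "m \<in> gens (monomial_ideal V A :: ('v, 'k) mpoly set)"
      then obtain a where "a \<in> A" "a \<subseteq># m"
        by (auto simp: gens_def monomial_in_monomial_ideal_iff)
      then have "monomial a \<in> (monomial_ideal V A :: ('v, 'k) mpoly set)"
        using assms by (auto simp: monomial_in_monomial_ideal_iff)
      with m \<open>a \<subseteq># m\<close> have "a = m" by (simp add: gens_def)
      with \<open>a \<in> A\<close> show "m \<in> A" by simp
    qed
  qed
qed

section \<open>Products of edges\<close>

text \<open>
  The recursion mirrors the power of an ideal in the monoid of ideals, which multiplies by the
  base on the right.
\<close>

primrec edge_products :: "'v set set \<Rightarrow> nat \<Rightarrow> 'v multiset set" where
  "edge_products E 0 = {{#}}"
| "edge_products E (Suc n) = {u + {#x, y#} | u x y. u \<in> edge_products E n \<and> {x, y} \<in> E}"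

lemma ideal_power_edge_ideal:
  assumes "\<And>e. e \<in> E \<Longrightarrow> e \<subseteq> V"
  shows "ideal_power V (edge_ideal V E) n =
           (monomial_ideal V (edge_products E n) :: ('v, 'k::field) mpoly set)"
proof (induction n)
  case 0
  show ?case by (auto simp: ideal_power_def nat_pow_def ideals_set_def monomial_ideal_def)
next
  case (Suc n)
  have "{monomial {#x, y#} | x y. {x, y} \<in> E} =
      (monomial ` {{#x, y#} | x y. {x, y} \<in> E} :: ('v, 'k) mpoly set)"
    by auto
  then have edge: "edge_ideal V E =
      (monomial_ideal V {{#x, y#} | x y. {x, y} \<in> E} :: ('v, 'k) mpoly set)"
    unfolding edge_ideal_def
    by (simp only:) (rule genideal_monomials, use assms in fastforce)
  have "ideal_power V (edge_ideal V E) (Suc n) =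
          ideal_power V (edge_ideal V E) n \<cdot>\<^bsub>poly_ring V\<^esub> (edge_ideal V E :: ('v, 'k) mpoly set)"
    by (simp add: ideal_power_def nat_pow_def ideals_set_def)
  also have "\<dots> = monomial_ideal V
      {a + b | a b. a \<in> edge_products E n \<and> b \<in> {{#x, y#} | x y. {x, y} \<in> E}}"
    unfolding Suc unfolding edge by (rule ideal_prod_monomial_ideals)
  also have "{a + b | a b. a \<in> edge_products E n \<and> b \<in> {{#x, y#} | x y. {x, y} \<in> E}} =
      edge_products E (Suc n)"
    by (simp only: edge_products.simps mem_Collect_eq) blast
  finally show ?case .
qed

lemma size_edge_products: "w \<in> edge_products E n \<Longrightarrow> size w = 2 * n"
  by (induction n arbitrary: w) auto

lemma set_mset_edge_products:
  assumes "\<And>e. e \<in> E \<Longrightarrow> e \<subseteq> V"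
  shows "w \<in> edge_products E n \<Longrightarrow> set_mset w \<subseteq> V"
proof (induction n arbitrary: w)
  case (Suc n)
  then obtain u x y where "w = u + {#x, y#}" "u \<in> edge_products E n" "{x, y} \<in> E" by auto
  with Suc.IH[of u] assms[of "{x, y}"] show ?case by simp
qed simp

lemma finite_edge_products:
  assumes "finite V" "\<And>e. e \<in> E \<Longrightarrow> e \<subseteq> V"
  shows "finite (edge_products E n)"
proof (induction n)
  case (Suc n)
  have "edge_products E (Suc n) \<subseteq>
      (\<lambda>(u, x, y). u + {#x, y#}) ` (edge_products E n \<times> V \<times> V)"
  proof
    fix w assume "w \<in> edge_products E (Suc n)"
    then obtain u x y where "w = u + {#x, y#}" "u \<in> edge_products E n" "{x, y} \<in> E" by auto
    with assms(2)[of "{x, y}"] show "w \<in> (\<lambda>(u, x, y). u + {#x, y#}) ` (edge_products E n \<times> V \<times> V)"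
      by (intro image_eqI[of _ _ "(u, x, y)"]) auto
  qed
  then show ?case using Suc assms(1) by (meson finite_SigmaI finite_imageI finite_subset)
qed simp

lemma edge_products_mono: "E \<subseteq> F \<Longrightarrow> edge_products E n \<subseteq> edge_products F n"
  by (induction n) (simp, simp only: edge_products.simps, blast)

lemma edge_products_empty: "edge_products {} n = (if n = 0 then {{#}} else {})"
  by (cases n) auto

lemma edge_products_restrict:
  "w \<in> edge_products E n \<Longrightarrow> set_mset w \<subseteq> W \<Longrightarrow> w \<in> edge_products {e \<in> E. e \<subseteq> W} n"
proof (induction n arbitrary: w)
  case (Suc n)
  then obtain u x y where w: "w = u + {#x, y#}" "u \<in> edge_products E n" "{x, y} \<in> E" by auto
  then have "u \<in> edge_products {e \<in> E. e \<subseteq> W} n" "{x, y} \<in> {e \<in> E. e \<subseteq> W}"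
    using Suc.IH[of u] Suc.prems(2) by simp_all
  then show ?case unfolding w(1) edge_products.simps by blast
qed simp

lemma edge_products_add_repeat:
  assumes "u \<in> edge_products E m" "{x, y} \<in> E"
  shows "u + repeat_mset i {#x, y#} \<in> edge_products E (m + i)"
proof (induction i)
  case (Suc i)
  have "u + repeat_mset (Suc i) {#x, y#} = (u + repeat_mset i {#x, y#}) + {#x, y#}"
    by (simp only: repeat_mset_Suc ac_simps)
  then show ?case using Suc assms(2) by (simp only: add_Suc_right edge_products.simps) blast
qed (use assms in simp)

text \<open>
  Splitting off one edge at a time turns membership for an explicit edge set into the existence of
  exponents, one for each edge.
\<close>

lemma edge_products_insert:
  "w \<in> edge_products (insert {x, y} E) n \<longleftrightarrow>
     (\<exists>i m u. n = m + i \<and> u \<in> edge_products E m \<and> w = u + repeat_mset i {#x, y#})"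
proof
  show "w \<in> edge_products (insert {x, y} E) n \<Longrightarrow>
     \<exists>i m u. n = m + i \<and> u \<in> edge_products E m \<and> w = u + repeat_mset i {#x, y#}"
  proof (induction n arbitrary: w)
    case (Suc n)
    then obtain w' a b where w': "w = w' + {#a, b#}" "w' \<in> edge_products (insert {x, y} E) n"
      and ab: "{a, b} \<in> insert {x, y} E" by auto
    obtain i m u where u: "n = m + i" "u \<in> edge_products E m" "w' = u + repeat_mset i {#x, y#}"
      using Suc.IH[OF w'(2)] by blast
    show ?case
    proof (cases "{a, b} = {x, y}")
      case True
      then have "{#a, b#} = {#x, y#}" by (auto simp: doubleton_eq_iff)
      then have "w = u + repeat_mset (Suc i) {#x, y#}"
        unfolding w' u by (simp only: repeat_mset_Suc ac_simps)
      then show ?thesis using u by (intro exI[of _ "Suc i"] exI[of _ m] exI[of _ u]) simp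
    next
      case False
      then have "u + {#a, b#} \<in> edge_products E (Suc m)" using ab u(2) by auto
      moreover have "w = (u + {#a, b#}) + repeat_mset i {#x, y#}"
        unfolding w' u by (simp only: ac_simps)
      ultimately show ?thesis using u(1) by (metis add_Suc)
    qed
  qed simp
  assume "\<exists>i m u. n = m + i \<and> u \<in> edge_products E m \<and> w = u + repeat_mset i {#x, y#}"
  then obtain i m u where "n = m + i" "u \<in> edge_products (insert {x, y} E) m"
    "w = u + repeat_mset i {#x, y#}"
    using edge_products_mono[of E "insert {x, y} E"] by blast
  then show "w \<in> edge_products (insert {x, y} E) n"
    by (simp only:) (rule edge_products_add_repeat, auto)
qed

lemma edges_within:
  assumes "\<forall>e\<in>E. card e = 2" "e \<in> E" "e \<subseteq> W"
  obtains x y where "x \<in> W" "y \<in> W" "x \<noteq> y" "e = {x, y}"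
  using assms by (metis card_2_iff insert_subset)

text \<open>
  A generator that divides a monomial supported on \<open>W\<close> is a product of edges inside \<open>W\<close>, so only a
  small part of the graph matters for divisibility below such a monomial.
\<close>

lemma edge_products_within:
  assumes w: "w \<in> edge_products E n" "set_mset w \<subseteq> W" and E: "\<forall>e\<in>E. card e = 2"
    and F: "\<And>x y. x \<in> W \<Longrightarrow> y \<in> W \<Longrightarrow> x \<noteq> y \<Longrightarrow> {x, y} \<in> E \<Longrightarrow> {x, y} \<in> F"
  shows "w \<in> edge_products F n"
proof -
  have "{e \<in> E. e \<subseteq> W} \<subseteq> F"
  proof
    fix e assume "e \<in> {e \<in> E. e \<subseteq> W}"
    then have e: "e \<in> E" "e \<subseteq> W" by auto
    obtain x y where "x \<in> W" "y \<in> W" "x \<noteq> y" "e = {x, y}" by (rule edges_within[OF E e])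
    then show "e \<in> F" using F e(1) by blast
  qed
  then show ?thesis using edge_products_restrict[OF w] edge_products_mono by blast
qed

section \<open>Minimality of the Lyubeznik resolution\<close>

lemma Sup_mset_mono:
  assumes "finite S" "T \<subseteq> S"
  shows "Sup T \<subseteq># (Sup S :: 'a multiset)"
proof (cases "T = {}")
  case False
  have "subset_mset.bdd_above S" using assms(1) by (rule subset_mset.bdd_above_finite)
  then show ?thesis using False assms(2) by (intro subset_mset.cSup_subset_mono) auto
qed (simp add: Sup_multiset_empty)

text \<open>
  A witness against criticality of \<open>\<tau>\<close> remains one for \<open>\<sigma>\<close>, since initial segments and their lcm only
  grow.  So the differential maps each module of the resolution to the next one.
\<close>

lemma lyubeznik_critical_subset:
  assumes crit: "lyubeznik_critical I r \<sigma>" and fin: "finite \<sigma>" and sub: "\<tau> \<subseteq> \<sigma>"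
  shows "lyubeznik_critical I r \<tau>"
  unfolding lyubeznik_critical_def
proof (intro conjI notI)
  show "\<tau> \<subseteq> gens I" using crit sub by (auto simp: lyubeznik_critical_def)
  assume "\<exists>m\<in>gens I. \<exists>p\<in>\<tau>. 1 < card {u \<in> \<tau>. (u, p) \<in> r} \<and> (p, m) \<in> r \<and> p \<noteq> m \<and>
            m \<subseteq># Sup {u \<in> \<tau>. (u, p) \<in> r}"
  then obtain m p where mp: "m \<in> gens I" "p \<in> \<tau>" "1 < card {u \<in> \<tau>. (u, p) \<in> r}"
    "(p, m) \<in> r" "p \<noteq> m" "m \<subseteq># Sup {u \<in> \<tau>. (u, p) \<in> r}" by blast
  have fin': "finite {u \<in> \<sigma>. (u, p) \<in> r}" and sub': "{u \<in> \<tau>. (u, p) \<in> r} \<subseteq> {u \<in> \<sigma>. (u, p) \<in> r}"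
    using fin sub by auto
  have "1 < card {u \<in> \<sigma>. (u, p) \<in> r}"
    using mp(3) card_mono[OF fin' sub'] by linarith
  moreover have "m \<subseteq># Sup {u \<in> \<sigma>. (u, p) \<in> r}"
    using mp(6) Sup_mset_mono[OF fin' sub'] by (rule subset_mset.order_trans)
  ultimately show False using crit mp sub unfolding lyubeznik_critical_def by blast
qed

lemma var_ideal_eq_monomial_ideal:
  "var_ideal V = (monomial_ideal V {{#v#} | v. v \<in> V} :: ('v, 'k::field) mpoly set)"
proof -
  have "{monomial {#v#} | v. v \<in> V} = (monomial ` {{#v#} | v. v \<in> V} :: ('v, 'k) mpoly set)"
    by auto
  then show ?thesis unfolding var_ideal_def by (simp only:) (rule genideal_monomials, auto)
qed

lemma monomial_in_var_ideal:
  assumes "set_mset m \<subseteq> V" "m \<noteq> {#}"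
  shows "(monomial m :: ('v, 'k::field) mpoly) \<in> var_ideal V"
proof -
  from assms(2) obtain v where "v \<in># m" by blast
  then have "{#v#} \<subseteq># m" "v \<in> V" using assms(1) by (auto simp: single_subset_iff)
  then show ?thesis using assms(1)
    unfolding var_ideal_eq_monomial_ideal monomial_in_monomial_ideal_iff by blast
qed

lemma constant_term_var_ideal:
  assumes "p \<in> var_ideal V"
  shows "Poly_Mapping.lookup p {#} = 0"
proof (rule ccontr)
  assume "Poly_Mapping.lookup p {#} \<noteq> 0"
  then have "{#} \<in> Poly_Mapping.keys p" by (simp add: in_keys_iff)
  with assms show False by (auto simp: var_ideal_eq_monomial_ideal monomial_ideal_def)
qed

lemma monomial_empty: "monomial {#} = 1"
  unfolding monomial_def zero_multiset_def[symmetric] by (rule single_one)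

lemma lookup_one_empty: "Poly_Mapping.lookup 1 {#} = 1"
  unfolding zero_multiset_def[symmetric] by (rule lookup_one_zero)

lemma lookup_taylor_diff:
  "Poly_Mapping.lookup (taylor_diff r f) \<tau> =
     (\<Sum>\<sigma> \<in> Poly_Mapping.keys f. \<Sum>m \<in> \<sigma>.
        (Poly_Mapping.lookup f \<sigma> * (- 1) ^ card {u \<in> \<sigma>. (u, m) \<in> r \<and> u \<noteq> m} *
           monomial (Sup \<sigma> - Sup (\<sigma> - {m})) when \<sigma> - {m} = \<tau>))"
  by (simp add: taylor_diff_def lookup_sum lookup_single)

text \<open>
  The coefficient of \<open>\<sigma> - {m}\<close> in the boundary of \<open>\<sigma>\<close> is, up to sign, the quotient of the two
  lcms.  If they agree, it is \<open>\<plusminus>1\<close>, whose constant term is not zero; otherwise it is a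
  nonconstant monomial.
\<close>

lemma minimal_lyubeznik_resolution_iff:
  fixes I :: "('v, 'k::field) mpoly set"
  assumes fin: "finite (gens I)" and V: "\<And>m. m \<in> gens I \<Longrightarrow> set_mset m \<subseteq> V"
  shows "minimal_lyubeznik_resolution V I r \<longleftrightarrow>
           (\<forall>\<sigma>. lyubeznik_critical I r \<sigma> \<longrightarrow> (\<forall>m\<in>\<sigma>. Sup (\<sigma> - {m}) \<noteq> Sup \<sigma>))"
proof (intro iffI allI impI ballI notI)
  have crit_fin: "finite \<sigma>" if "lyubeznik_critical I r \<sigma>" for \<sigma>
    using that fin finite_subset by (auto simp: lyubeznik_critical_def)
  interpret R: cring "poly_ring V :: ('v, 'k) mpoly ring" by (rule cring_poly_ring)
  {
    fix \<sigma> m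
    assume min: "minimal_lyubeznik_resolution V I r" and crit: "lyubeznik_critical I r \<sigma>"
      and m: "m \<in> \<sigma>" and eq: "Sup (\<sigma> - {m}) = Sup \<sigma>"
    (* The boundary of the basis element \<sigma> has the unit coefficient at \<sigma> - {m}, because
       distinct elements of \<sigma> give distinct facets. *)
    define f :: "'v multiset set \<Rightarrow>\<^sub>0 ('v, 'k) mpoly" where "f = Poly_Mapping.single \<sigma> 1"
    define c where "c = card {u \<in> \<sigma>. (u, m) \<in> r \<and> u \<noteq> m}"
    have fin\<sigma>: "finite \<sigma>" by (rule crit_fin[OF crit])
    obtain i where "card \<sigma> = Suc i"
      using m fin\<sigma> by (metis card_Suc_Diff1)
    then have "f \<in> lyubeznik_module V I r (Suc i)"
      using crit by (auto simp: f_def lyubeznik_module_def lookup_single when_def poly_ring_def)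
    then have "Poly_Mapping.lookup (taylor_diff r f) (\<sigma> - {m}) \<in> var_ideal V"
      using min by (auto simp: minimal_lyubeznik_resolution_def)
    moreover have "Poly_Mapping.lookup (taylor_diff r f) (\<sigma> - {m}) = (- 1) ^ c"
    proof -
      have "\<sigma> - {m'} = \<sigma> - {m} \<longleftrightarrow> m' = m" if "m' \<in> \<sigma>" for m' using that m by blast
      then have "Poly_Mapping.lookup (taylor_diff r f) (\<sigma> - {m}) =
          (\<Sum>m'\<in>\<sigma>. ((- 1) ^ c * monomial {#} when m' = m))"
        unfolding lookup_taylor_diff
        by (simp add: f_def c_def eq when_def cong: if_cong)
      also have "\<dots> = (- 1) ^ c"
        using fin\<sigma> m by (simp add: when_def monomial_empty)
      finally show ?thesis .
    qed
    moreover have "Poly_Mapping.lookup ((- 1) ^ c :: ('v, 'k) mpoly) {#} \<noteq> 0"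
      by (cases "even c") (simp_all add: lookup_one_empty)
    ultimately show False using constant_term_var_ideal by fastforce
  }
  assume irr: "\<forall>\<sigma>. lyubeznik_critical I r \<sigma> \<longrightarrow> (\<forall>m\<in>\<sigma>. Sup (\<sigma> - {m}) \<noteq> Sup \<sigma>)"
  have J: "ideal (var_ideal V :: ('v, 'k) mpoly set) (poly_ring V)"
    unfolding var_ideal_eq_monomial_ideal by (rule ideal_monomial_ideal)
  show "minimal_lyubeznik_resolution V I r"
    unfolding minimal_lyubeznik_resolution_def
  proof (intro allI subsetI, elim imageE)
    fix i g f
    assume f: "f \<in> lyubeznik_module V I r (Suc i)" and g: "g = taylor_diff r f"
    have coeff: "Poly_Mapping.lookup f \<sigma> * (- 1) ^ c * monomial (Sup \<sigma> - Sup (\<sigma> - {m})) \<in> var_ideal V"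
      if \<sigma>: "\<sigma> \<in> Poly_Mapping.keys f" and m: "m \<in> \<sigma>" for \<sigma> m and c :: nat
    proof -
      have crit: "lyubeznik_critical I r \<sigma>" using f \<sigma> by (simp add: lyubeznik_module_def)
      let ?q = "Sup \<sigma> - Sup (\<sigma> - {m})"
      have "Sup (\<sigma> - {m}) \<subseteq># Sup \<sigma>" using crit_fin[OF crit] by (intro Sup_mset_mono) auto
      then have "?q \<noteq> {#}" using irr crit m by (metis subset_mset.diff_add add_0)
      moreover have "set_mset ?q \<subseteq> V"
      proof
        fix v assume "v \<in># ?q"
        then obtain u where "u \<in> \<sigma>" "v \<in># u" by (meson in_diffD in_Sup_multisetD)
        then show "v \<in> V" using V crit by (auto simp: lyubeznik_critical_def)
      qed
      ultimately have q: "monomial ?q \<in> (var_ideal V :: ('v, 'k) mpoly set)"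
        by (intro monomial_in_var_ideal)
      have "Poly_Mapping.lookup f \<sigma> \<in> carrier (poly_ring V)" using f by (simp add: lyubeznik_module_def)
      then have "Poly_Mapping.lookup f \<sigma> * (- 1) ^ c \<in> carrier (poly_ring V)"
        by (cases "even c") (simp_all add: poly_ring_def)
      then show ?thesis using q by (rule ideal_mult_closed[OF J])
    qed
    have var: "Poly_Mapping.lookup g \<tau> \<in> var_ideal V" for \<tau>
      unfolding g lookup_taylor_diff
      by (intro ideal_sum_closed[OF J]) (auto simp: when_def coeff ideal_zero_closed[OF J])
    have "lyubeznik_critical I r \<tau> \<and> card \<tau> = i" if \<tau>: "\<tau> \<in> Poly_Mapping.keys g" for \<tau>
    proof -
      have "\<exists>\<sigma>\<in>Poly_Mapping.keys f. \<exists>m\<in>\<sigma>. \<sigma> - {m} = \<tau>"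
      proof (rule ccontr)
        assume "\<not> ?thesis"
        then have "Poly_Mapping.lookup g \<tau> = 0"
          unfolding g lookup_taylor_diff by (intro sum.neutral ballI) (auto simp: when_def)
        with \<tau> show False by (simp add: in_keys_iff)
      qed
      then obtain \<sigma> m where \<sigma>: "\<sigma> \<in> Poly_Mapping.keys f" "m \<in> \<sigma>" "\<sigma> - {m} = \<tau>" by blast
      then have crit: "lyubeznik_critical I r \<sigma>" and card: "card \<sigma> = Suc i"
        using f by (auto simp: lyubeznik_module_def)
      have "lyubeznik_critical I r \<tau>"
        using lyubeznik_critical_subset[OF crit crit_fin[OF crit]] \<sigma>(3) by blast
      moreover have "card \<tau> = i" using card \<sigma> crit_fin[OF crit] by auto
      ultimately show ?thesis by blast
    qed
    then show "g \<in> {g \<in> lyubeznik_module V I r i. \<forall>\<tau>. Poly_Mapping.lookup g \<tau> \<in> var_ideal V}"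
      using var ideal.Icarr[OF J] by (simp add: lyubeznik_module_def)
  qed
qed

lemma lyubeznik_ideal_iff:
  fixes I :: "('v, 'k::field) mpoly set"
  assumes "finite (gens I)" "\<And>m. m \<in> gens I \<Longrightarrow> set_mset m \<subseteq> V"
  shows "lyubeznik_ideal V I \<longleftrightarrow> (\<exists>r. linear_order_on (gens I) r \<and>
           (\<forall>\<sigma>. lyubeznik_critical I r \<sigma> \<longrightarrow> (\<forall>m\<in>\<sigma>. Sup (\<sigma> - {m}) \<noteq> Sup \<sigma>)))"
  unfolding lyubeznik_ideal_def using minimal_lyubeznik_resolution_iff[OF assms] by simp

section \<open>An obstruction to minimality for all orders\<close>

lemma Sup_insert_mset:
  assumes "finite S"
  shows "Sup (insert x S) = x \<union># (Sup S :: 'a multiset)"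
proof (cases "S = {}")
  case False
  then show ?thesis
    using assms by (intro subset_mset.cSup_insert subset_mset.bdd_above_finite)
qed (simp add: Sup_multiset_empty)

text \<open>
  In every total order, the least \<open>x \<in> B\<close> comes with a critical triple \<open>{x, y, z}\<close> in which \<open>y\<close> is
  redundant, where \<open>y\<close> is the smaller of \<open>y\<^sub>1\<close> and \<open>y\<^sub>2\<close>.  The case \<open>y\<^sub>1 = y\<^sub>2\<close> is allowed: then
  \<open>y\<^sub>1\<close> and \<open>z\<close> are the only generators that divide their lcm.
\<close>

definition obstructed :: "'v multiset set \<Rightarrow> bool" where
  "obstructed A \<longleftrightarrow> (\<exists>B\<subseteq>A. finite B \<and> B \<noteq> {} \<and> (\<forall>x\<in>B. \<exists>z\<in>A. \<exists>y\<^sub>1\<in>A. \<exists>y\<^sub>2\<in>A.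
     x \<noteq> z \<and> {y\<^sub>1, y\<^sub>2} \<inter> {x, z} = {} \<and> y\<^sub>1 \<subseteq># x \<union># z \<and> y\<^sub>2 \<subseteq># x \<union># z \<and>
     (\<forall>w\<in>A. w \<subseteq># x \<union># z \<longrightarrow> w \<in> B) \<and>
     (\<forall>w\<in>A. w \<subseteq># y\<^sub>1 \<union># z \<or> w \<subseteq># y\<^sub>2 \<union># z \<longrightarrow> w \<in> {z, y\<^sub>1, y\<^sub>2})))"

lemma linear_order_on_has_least:
  assumes "linear_order_on A r" "finite B" "B \<noteq> {}" "B \<subseteq> A"
  shows "\<exists>x\<in>B. \<forall>w\<in>B. (w, x) \<in> r"
  using assms(2-4)
proof (induction B rule: finite_ne_induct)
  case (singleton x)
  then show ?case using partial_order_onD(1) assms(1)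
    by (auto simp: linear_order_on_def refl_on_def)
next
  case (insert b B)
  then obtain x where x: "x \<in> B" "\<forall>w\<in>B. (w, x) \<in> r" by auto
  have r: "refl_on A r" "trans r" "total_on A r"
    using assms(1) partial_order_onD by (auto simp: linear_order_on_def)
  have "b \<in> A" "x \<in> A" using insert.prems x(1) by auto
  then have "(b, x) \<in> r \<or> (x, b) \<in> r" "(b, b) \<in> r"
    using r(1,3) by (cases "b = x"; auto simp: total_on_def refl_on_def)+
  then show ?case
  proof (elim disjE)
    assume "(b, x) \<in> r"
    then show ?thesis using x by blast
  next
    assume "(x, b) \<in> r"
    then have "\<forall>w\<in>insert b B. (w, b) \<in> r" using x(2) \<open>(b, b) \<in> r\<close> transD[OF r(2)] by blast
    then show ?thesis by blast
  qed
qed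

text \<open>
  A witness \<open>m\<close> against criticality of \<open>{x, y, z}\<close> divides \<open>lcm(x, z)\<close>, hence lies in \<open>B\<close> and is not
  below \<open>x\<close>.  So the segment that it violates is \<open>{y, z}\<close>, and \<open>m\<close> is one of \<open>z\<close>, \<open>y\<close> and the other
  candidate, none of which is strictly below both \<open>y\<close> and \<open>z\<close>.
\<close>

lemma obstructed_imp_redundant_critical:
  fixes I :: "('v, 'k::field) mpoly set"
  assumes r: "linear_order_on (gens I) r" and obs: "obstructed (gens I)"
  shows "\<exists>\<sigma> y. lyubeznik_critical I r \<sigma> \<and> y \<in> \<sigma> \<and> Sup (\<sigma> - {y}) = Sup \<sigma>"
proof -
  have po: "partial_order_on (gens I) r" and total: "total_on (gens I) r"
    using r by (simp_all add: linear_order_on_def)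
  note r_refl = refl_onD[OF partial_order_onD(1)[OF po]]
    and trans = partial_order_onD(2)[OF po] and antisym = partial_order_onD(3)[OF po]
  obtain B where B: "B \<subseteq> gens I" "finite B" "B \<noteq> {}"
    and step: "\<forall>x\<in>B. \<exists>z\<in>gens I. \<exists>y\<^sub>1\<in>gens I. \<exists>y\<^sub>2\<in>gens I.
     x \<noteq> z \<and> {y\<^sub>1, y\<^sub>2} \<inter> {x, z} = {} \<and> y\<^sub>1 \<subseteq># x \<union># z \<and> y\<^sub>2 \<subseteq># x \<union># z \<and>
     (\<forall>w\<in>gens I. w \<subseteq># x \<union># z \<longrightarrow> w \<in> B) \<and>
     (\<forall>w\<in>gens I. w \<subseteq># y\<^sub>1 \<union># z \<or> w \<subseteq># y\<^sub>2 \<union># z \<longrightarrow> w \<in> {z, y\<^sub>1, y\<^sub>2})"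
    using obs unfolding obstructed_def by (elim exE conjE)
  obtain x where x: "x \<in> B" "\<And>w. w \<in> B \<Longrightarrow> (w, x) \<in> r"
    using linear_order_on_has_least[OF r B(2,3,1)] by blast
  obtain z y\<^sub>1 y\<^sub>2 where gens: "z \<in> gens I" "y\<^sub>1 \<in> gens I" "y\<^sub>2 \<in> gens I"
    and ne: "x \<noteq> z" "{y\<^sub>1, y\<^sub>2} \<inter> {x, z} = {}"
    and ydiv: "y\<^sub>1 \<subseteq># x \<union># z" "y\<^sub>2 \<subseteq># x \<union># z"
    and all_inB: "\<forall>w\<in>gens I. w \<subseteq># x \<union># z \<longrightarrow> w \<in> B"
    and all_small: "\<forall>w\<in>gens I. w \<subseteq># y\<^sub>1 \<union># z \<or> w \<subseteq># y\<^sub>2 \<union># z \<longrightarrow> w \<in> {z, y\<^sub>1, y\<^sub>2}"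
    using bspec[OF step x(1)] by (elim bexE conjE) (rule that)
  note inB = all_inB[rule_format] and small = all_small[rule_format]
  obtain y y' where yy: "{y, y'} = {y\<^sub>1, y\<^sub>2}" and y'y: "(y', y) \<in> r"
  proof (cases "(y\<^sub>2, y\<^sub>1) \<in> r")
    case True
    then show ?thesis by (rule that[OF refl])
  next
    case False
    then have "(y\<^sub>1, y\<^sub>2) \<in> r"
      using total[unfolded total_on_def, rule_format, OF gens(2,3)] r_refl[OF gens(2)] by (cases "y\<^sub>1 = y\<^sub>2") auto
    then show ?thesis by (rule that[OF insert_commute])
  qed
  have yy': "y = y\<^sub>1 \<and> y' = y\<^sub>2 \<or> y = y\<^sub>2 \<and> y' = y\<^sub>1"
    using yy by (simp add: doubleton_eq_iff)
  have y: "y \<in> gens I" "y \<noteq> x" "y \<noteq> z" "y \<subseteq># x \<union># z"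
    using yy' gens ne ydiv by auto
  have ysmall: "w \<in> {z, y, y'}" if "w \<in> gens I" "w \<subseteq># y \<union># z" for w
    using small[OF that(1)] that(2) yy' by auto
  have "z \<subseteq># x \<union># z" by simp
  then have inB': "y \<in> B" "z \<in> B" using inB y(1,4) gens(1) by auto
  define \<sigma> where "\<sigma> = {x, y, z}"
  have Sup\<sigma>: "Sup \<sigma> = x \<union># z"
    unfolding \<sigma>_def insert_commute[of x y] using y(4)
    by (simp add: Sup_insert_mset Sup_multiset_empty subset_mset.sup_absorb2)
  have "Sup (\<sigma> - {y}) = x \<union># z"
  proof -
    have "\<sigma> - {y} = {x, z}" using y ne by (auto simp: \<sigma>_def)
    then show ?thesis by (simp add: Sup_insert_mset Sup_multiset_empty)
  qed
  moreover have "lyubeznik_critical I r \<sigma>"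
    unfolding lyubeznik_critical_def
  proof (intro conjI notI)
    show "\<sigma> \<subseteq> gens I" using x(1) B(1) y(1) gens(1) by (auto simp: \<sigma>_def)
    assume "\<exists>m\<in>gens I. \<exists>p\<in>\<sigma>. 1 < card {u \<in> \<sigma>. (u, p) \<in> r} \<and> (p, m) \<in> r \<and> p \<noteq> m \<and>
              m \<subseteq># Sup {u \<in> \<sigma>. (u, p) \<in> r}"
    then obtain m p where m: "m \<in> gens I" and p: "p \<in> \<sigma>"
      and card: "1 < card {u \<in> \<sigma>. (u, p) \<in> r}"
      and pm: "(p, m) \<in> r" "p \<noteq> m" and mdiv: "m \<subseteq># Sup {u \<in> \<sigma>. (u, p) \<in> r}" by blast
    have "Sup {u \<in> \<sigma>. (u, p) \<in> r} \<subseteq># x \<union># z"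
      unfolding Sup\<sigma>[symmetric] by (rule Sup_mset_mono) (auto simp: \<sigma>_def)
    then have "m \<subseteq># x \<union># z" using mdiv by (rule subset_mset.order_trans[rotated])
    then have mx: "(m, x) \<in> r" using x(2) inB[OF m] by blast
    (* The least element x is the last one of \<sigma>; the violated segment ends earlier. *)
    have "p \<noteq> x" using mx pm antisym by (auto dest: antisymD)
    then have "(x, p) \<notin> r" using p inB' x(2) antisym by (auto simp: \<sigma>_def dest: antisymD)
    then have sub: "{u \<in> \<sigma>. (u, p) \<in> r} \<subseteq> {y, z}" by (auto simp: \<sigma>_def)
    moreover have "card {y, z} = 2" using y(3) by simp
    ultimately have eq: "{u \<in> \<sigma>. (u, p) \<in> r} = {y, z}"
      using card by (intro card_seteq) auto
    then have "(y, p) \<in> r" "(z, p) \<in> r" by auto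
    have "m \<subseteq># y \<union># z" using mdiv unfolding eq by (simp add: Sup_insert_mset Sup_multiset_empty)
    then have "m \<in> {z, y, y'}" by (rule ysmall[OF m])
    then have "(m, p) \<in> r"
      using \<open>(y, p) \<in> r\<close> \<open>(z, p) \<in> r\<close> y'y trans by (auto dest: transD)
    then show False using pm antisym by (auto dest: antisymD)
  qed
  ultimately show ?thesis using Sup\<sigma> by (intro exI[of _ \<sigma>] exI[of _ y]) (auto simp: \<sigma>_def)
qed

text \<open>
  In the applications \<open>B\<close> is parametrised by exponent vectors, and \<open>btw s p q\<close> expresses divisibility
  of the lcm by inequalities between exponents.  The last assumption is then plain arithmetic.
\<close>

lemma obstructedI:
  fixes t :: "'i \<Rightarrow> 'v multiset"
  assumes T: "finite T" "T \<noteq> {}" "\<And>p. p \<in> T \<Longrightarrow> t p \<in> A" and inj: "inj_on t T"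
    and closed: "\<And>p q w. p \<in> T \<Longrightarrow> q \<in> T \<Longrightarrow> w \<in> A \<Longrightarrow> w \<subseteq># t p \<union># t q \<Longrightarrow> w \<in> t ` T"
    and between: "\<And>s p q. s \<in> T \<Longrightarrow> p \<in> T \<Longrightarrow> q \<in> T \<Longrightarrow> t s \<subseteq># t p \<union># t q \<longleftrightarrow> btw s p q"
    and step: "\<And>p. p \<in> T \<Longrightarrow> \<exists>z\<in>T. \<exists>y\<^sub>1\<in>T. \<exists>y\<^sub>2\<in>T.
      p \<noteq> z \<and> {y\<^sub>1, y\<^sub>2} \<inter> {p, z} = {} \<and> btw y\<^sub>1 p z \<and> btw y\<^sub>2 p z \<and>
      (\<forall>s\<in>T. btw s y\<^sub>1 z \<or> btw s y\<^sub>2 z \<longrightarrow> s \<in> {z, y\<^sub>1, y\<^sub>2})"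
  shows "obstructed A"
  unfolding obstructed_def
proof (intro exI[of _ "t ` T"] conjI ballI)
  show "t ` T \<subseteq> A" "finite (t ` T)" "t ` T \<noteq> {}" using T by auto
  fix x assume "x \<in> t ` T"
  then obtain p where p: "p \<in> T" "x = t p" by blast
  obtain z y\<^sub>1 y\<^sub>2 where zy: "z \<in> T" "y\<^sub>1 \<in> T" "y\<^sub>2 \<in> T"
    and ne: "p \<noteq> z" "{y\<^sub>1, y\<^sub>2} \<inter> {p, z} = {}" and btw: "btw y\<^sub>1 p z" "btw y\<^sub>2 p z"
    and small: "\<And>s. s \<in> T \<Longrightarrow> btw s y\<^sub>1 z \<or> btw s y\<^sub>2 z \<Longrightarrow> s \<in> {z, y\<^sub>1, y\<^sub>2}"
    using step[OF p(1)] by blast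
  have "t p \<noteq> t z" "{t y\<^sub>1, t y\<^sub>2} \<inter> {t p, t z} = {}"
    using ne zy p(1) by (auto simp: inj_on_eq_iff[OF inj])
  moreover have "t y\<^sub>1 \<subseteq># t p \<union># t z" "t y\<^sub>2 \<subseteq># t p \<union># t z"
    using btw zy p(1) by (simp_all add: between)
  moreover have "\<forall>w\<in>A. w \<subseteq># t p \<union># t z \<longrightarrow> w \<in> t ` T"
    using closed p(1) zy(1) by blast
  moreover have "\<forall>w\<in>A. w \<subseteq># t y\<^sub>1 \<union># t z \<or> w \<subseteq># t y\<^sub>2 \<union># t z \<longrightarrow> w \<in> {t z, t y\<^sub>1, t y\<^sub>2}"
  proof (intro ballI impI)
    fix w assume w: "w \<in> A" "w \<subseteq># t y\<^sub>1 \<union># t z \<or> w \<subseteq># t y\<^sub>2 \<union># t z"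
    then have "w \<in> t ` T" using closed zy by blast
    then obtain s where s: "s \<in> T" "w = t s" by blast
    then have "s \<in> {z, y\<^sub>1, y\<^sub>2}" using small w(2) zy by (simp add: between)
    then show "w \<in> {t z, t y\<^sub>1, t y\<^sub>2}" using s by auto
  qed
  ultimately show "\<exists>z\<in>A. \<exists>y\<^sub>1\<in>A. \<exists>y\<^sub>2\<in>A.
     x \<noteq> z \<and> {y\<^sub>1, y\<^sub>2} \<inter> {x, z} = {} \<and> y\<^sub>1 \<subseteq># x \<union># z \<and> y\<^sub>2 \<subseteq># x \<union># z \<and>
     (\<forall>w\<in>A. w \<subseteq># x \<union># z \<longrightarrow> w \<in> t ` T) \<and>
     (\<forall>w\<in>A. w \<subseteq># y\<^sub>1 \<union># z \<or> w \<subseteq># y\<^sub>2 \<union># z \<longrightarrow> w \<in> {z, y\<^sub>1, y\<^sub>2})"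
    unfolding p(2)
    by (intro bexI[of _ "t z"] bexI[of _ "t y\<^sub>1"] bexI[of _ "t y\<^sub>2"] conjI T(3) zy) assumption+
qed

section \<open>Obstructions from small subgraphs\<close>

lemma set_mset_dvd_lcm: "w \<subseteq># u \<union># v \<Longrightarrow> set_mset w \<subseteq> set_mset u \<union> set_mset v"
  using set_mset_mono[of w "u \<union># v"] by simp

lemma subseteq_mset_iff_on:
  assumes "set_mset u \<subseteq> W"
  shows "u \<subseteq># w \<longleftrightarrow> (\<forall>v\<in>W. count u v \<le> count w v)"
proof -
  have "count u v = 0" if "v \<notin> W" for v
    using assms that by (auto simp: count_eq_zero_iff)
  then show ?thesis unfolding subseteq_mset_def by (metis le0)
qed

text \<open>
  The products \<open>t i = (ab)\<^sup>i(bc)\<^sup>n\<^sup>-\<^sup>i\<close> form a chain: \<open>t s\<close> divides \<open>lcm(t p, t q)\<close> if and only if \<open>s\<close>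
  lies between \<open>p\<close> and \<open>q\<close>.  From each \<open>p\<close> one can walk two steps in some direction, as there are at
  least four elements; the first step is \<open>y\<^sub>1 = y\<^sub>2\<close> and the second is \<open>z\<close>.
\<close>

lemma obstructed_two_edge_path:
  assumes E: "\<forall>e\<in>E. card e = 2" and abc: "distinct [a, b, c]"
    and edges: "{a, b} \<in> E" "{b, c} \<in> E" and ac: "{a, c} \<notin> E" and n: "3 \<le> n"
  shows "obstructed (edge_products E n)"
proof -
  define t where "t i = repeat_mset i {#a, b#} + repeat_mset (n - i) {#b, c#}" for i
  have neq: "a \<noteq> b" "a \<noteq> c" "b \<noteq> c" using abc by auto
  have count: "count (t i) a = i" "count (t i) b = i + (n - i)" "count (t i) c = n - i"
    "v \<noteq> a \<Longrightarrow> v \<noteq> b \<Longrightarrow> v \<noteq> c \<Longrightarrow> count (t i) v = 0" for i v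
    using abc by (auto simp: t_def)
  have set: "set_mset (t i) \<subseteq> {a, b, c}" for i
    by (auto simp: t_def)
  show ?thesis
  proof (rule obstructedI[of "{..n}" t _ "\<lambda>s p q. min p q \<le> s \<and> s \<le> max p q"])
    show "finite {..n}" "{..n} \<noteq> {}" by auto
    show "t i \<in> edge_products E n" if "i \<in> {..n}" for i
    proof -
      have "repeat_mset i {#a, b#} \<in> edge_products E i"
        using edge_products_add_repeat[of "{#}" E 0 a b i] edges by simp
      from edge_products_add_repeat[OF this edges(2), of "n - i"] show ?thesis
        using that by (simp add: t_def)
    qed
    show "inj_on t {..n}" by (rule inj_onI) (metis count(1))
    show "w \<in> t ` {..n}" if "p \<in> {..n}" "q \<in> {..n}" and w: "w \<in> edge_products E n" "w \<subseteq># t p \<union># t q"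
      for p q w
    proof -
      have "set_mset w \<subseteq> {a, b, c}" using set_mset_dvd_lcm[OF w(2)] set by blast
      then have "w \<in> edge_products {{a, b}, {b, c}} n"
        by (rule edge_products_within[OF w(1) _ E])
          (use ac in \<open>auto simp: insert_commute\<close>)
      then obtain i j where "w = repeat_mset i {#a, b#} + repeat_mset j {#b, c#}" "i + j = n"
        by (auto simp: edge_products_insert edge_products_empty add.commute
            simp del: repeat_mset_distrib_add_mset split: if_splits)
      then have "w = t i" "i \<le> n" by (auto simp: t_def)
      then show ?thesis by auto
    qed
    show "t s \<subseteq># t p \<union># t q \<longleftrightarrow> min p q \<le> s \<and> s \<le> max p q"
      if "s \<in> {..n}" "p \<in> {..n}" "q \<in> {..n}" for s p q
    proof
      assume le: "t s \<subseteq># t p \<union># t q"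
      show "min p q \<le> s \<and> s \<le> max p q"
        using mset_subset_eq_count[OF le, of a] mset_subset_eq_count[OF le, of c] that
        by (auto simp: count)
    next
      assume "min p q \<le> s \<and> s \<le> max p q"
      then have "count (t s) v \<le> count (t p \<union># t q) v" for v
        using that by (cases "v = a"; cases "v = b"; cases "v = c") (auto simp: count)
      then show "t s \<subseteq># t p \<union># t q" by (simp add: subseteq_mset_def)
    qed
    show "\<exists>z\<in>{..n}. \<exists>y\<^sub>1\<in>{..n}. \<exists>y\<^sub>2\<in>{..n}. p \<noteq> z \<and> {y\<^sub>1, y\<^sub>2} \<inter> {p, z} = {} \<and>
        (min p z \<le> y\<^sub>1 \<and> y\<^sub>1 \<le> max p z) \<and> (min p z \<le> y\<^sub>2 \<and> y\<^sub>2 \<le> max p z) \<and>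
        (\<forall>s\<in>{..n}. (min y\<^sub>1 z \<le> s \<and> s \<le> max y\<^sub>1 z) \<or> (min y\<^sub>2 z \<le> s \<and> s \<le> max y\<^sub>2 z) \<longrightarrow>
           s \<in> {z, y\<^sub>1, y\<^sub>2})" if "p \<in> {..n}" for p
    proof (cases "p + 2 \<le> n")
      case True
      then show ?thesis
        by (intro bexI[of _ "p + 2"] bexI[of _ "p + 1"]) (auto simp: min_def max_def)
    next
      case False
      then show ?thesis using that n
        by (intro bexI[of _ "p - 2"] bexI[of _ "p - 1"]) (auto simp: min_def max_def)
    qed
  qed
qed

text \<open>
  The exponent of \<open>a\<close> in \<open>t (i, j, k) = (ab)\<^sup>i(bc)\<^sup>j(ca)\<^sup>k\<close> is \<open>n - j\<close>, and similarly for the other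
  vertices.  So \<open>t s\<close> divides an lcm if and only if \<open>s\<close> is coordinatewise at least the minimum.  In this
  triangular grid \<open>z\<close>, \<open>y\<^sub>1\<close> and \<open>y\<^sub>2\<close> form a small triangle: the minimum of \<open>z\<close> and \<open>y\<^sub>1\<close> and that of \<open>z\<close>
  and \<open>y\<^sub>2\<close> are the same vector, of coordinate sum \<open>n - 1\<close>, and only these three points lie above it.
\<close>

lemma obstructed_triangle:
  assumes E: "\<forall>e\<in>E. card e = 2" and abc: "distinct [a, b, c]"
    and edges: "{a, b} \<in> E" "{b, c} \<in> E" "{c, a} \<in> E" and n: "2 \<le> n"
  shows "obstructed (edge_products E n)"
proof -
  define t where "t = (\<lambda>(i, j, k). repeat_mset i {#a, b#} + repeat_mset j {#b, c#} +
                         repeat_mset k {#c, a#})"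
  define T where "T = {(i, j, k) | i j k. i + j + k = n}"
  define btw where "btw = (\<lambda>(i :: nat, j :: nat, k :: nat) (i', j', k') (i'', j'', k'').
      min i' i'' \<le> i \<and> min j' j'' \<le> j \<and> min k' k'' \<le> k)"
  have T_iff: "(i, j, k) \<in> T \<longleftrightarrow> i + j + k = n" for i j k
    unfolding T_def by simp
  have neq: "a \<noteq> b" "a \<noteq> c" "b \<noteq> c" using abc by auto
  have count: "count (t (i, j, k)) a = i + k" "count (t (i, j, k)) b = i + j"
    "count (t (i, j, k)) c = j + k"
    "v \<noteq> a \<Longrightarrow> v \<noteq> b \<Longrightarrow> v \<noteq> c \<Longrightarrow> count (t (i, j, k)) v = 0" for i j k v
    using neq by (simp_all add: t_def)
  have set: "set_mset (t p) \<subseteq> {a, b, c}" for p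
    by (auto simp: t_def split: prod.splits)
  show ?thesis
  proof (rule obstructedI[of T t _ btw])
    have "T \<subseteq> {..n} \<times> {..n} \<times> {..n}" by (auto simp: T_def)
    then show "finite T" by (rule finite_subset) auto
    have "(n, 0, 0) \<in> T" by (simp add: T_def)
    then show "T \<noteq> {}" by blast
    show "t p \<in> edge_products E n" if pT: "p \<in> T" for p
    proof -
      obtain i j k where p: "p = (i, j, k)" "i + j + k = n" using pT by (auto simp: T_def)
      have "repeat_mset i {#a, b#} \<in> edge_products E i"
        using edge_products_add_repeat[of "{#}" E 0 a b i] edges by simp
      from edge_products_add_repeat[OF edge_products_add_repeat[OF this edges(2)] edges(3)]
      show ?thesis unfolding p(2)[symmetric] by (simp add: p(1) t_def)
    qed
    show "inj_on t T"
    proof (rule inj_onI)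
      fix p q assume "p \<in> T" "q \<in> T" and eq: "t p = t q"
      then obtain i j k i' j' k' where "p = (i, j, k)" "q = (i', j', k')" "i + j + k = n" "i' + j' + k' = n"
        by (auto simp: T_def)
      with eq count(1,2)[of i j k] count(1,2)[of i' j' k'] show "p = q" by auto
    qed
    show "w \<in> t ` T" if "p \<in> T" "q \<in> T" and w: "w \<in> edge_products E n" "w \<subseteq># t p \<union># t q"
      for p q w
    proof -
      have "set_mset w \<subseteq> {a, b, c}" using set_mset_dvd_lcm[OF w(2)] set by blast
      then have "w \<in> edge_products {{a, b}, {b, c}, {c, a}} n"
        by (rule edge_products_within[OF w(1) _ E]) (auto simp: insert_commute)
      then obtain i j k where "w = t (i, j, k)" "i + j + k = n"
        by (auto simp: edge_products_insert edge_products_empty t_def ac_simps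
            simp del: repeat_mset_distrib_add_mset split: if_splits)
      then show ?thesis by (auto simp: T_def)
    qed
    show "t s \<subseteq># t p \<union># t q \<longleftrightarrow> btw s p q" if "s \<in> T" "p \<in> T" "q \<in> T" for s p q
    proof -
      obtain i j k i' j' k' i'' j'' k'' where
        spq: "s = (i, j, k)" "p = (i', j', k')" "q = (i'', j'', k'')"
        by (cases s; cases p; cases q)
      then have n: "i + j + k = n" "i' + j' + k' = n" "i'' + j'' + k'' = n"
        using that by (auto simp: T_def)
      (* The count of a vertex is n minus the exponent of the opposite edge. *)
      have le_iff: "x + y \<le> max (x' + y') (x'' + y'') \<longleftrightarrow> min z' z'' \<le> z"
        if "x + y + z = n" "x' + y' + z' = n" "x'' + y'' + z'' = n" for x y z x' y' z' x'' y'' z''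
        using that by (auto simp: le_max_iff_disj min_le_iff_disj)
      show ?thesis
        using le_iff[of i k j i' k' j' i'' k'' j''] le_iff[of i j k i' j' k' i'' j'' k'']
          le_iff[of j k i j' k' i' j'' k'' i''] n
        by (simp add: subseteq_mset_iff_on[OF set] spq count btw_def ac_simps)
    qed
    show "\<exists>z\<in>T. \<exists>y\<^sub>1\<in>T. \<exists>y\<^sub>2\<in>T. p \<noteq> z \<and> {y\<^sub>1, y\<^sub>2} \<inter> {p, z} = {} \<and> btw y\<^sub>1 p z \<and> btw y\<^sub>2 p z \<and>
        (\<forall>s\<in>T. btw s y\<^sub>1 z \<or> btw s y\<^sub>2 z \<longrightarrow> s \<in> {z, y\<^sub>1, y\<^sub>2})" if "p \<in> T" for p
    proof -
      obtain i j k where p: "p = (i, j, k)" by (cases p)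
      then have sum: "i + j + k = n" using that by (simp add: T_def)
      (* Two positive coordinates: z lowers both by one and raises the third by two.
         A corner of the grid: z lowers the only nonzero coordinate by two. *)
      consider "1 \<le> i" "1 \<le> j" | "1 \<le> j" "1 \<le> k" | "1 \<le> i" "1 \<le> k"
        | "2 \<le> i" "j = 0" "k = 0" | "i = 0" "2 \<le> j" "k = 0" | "i = 0" "j = 0" "2 \<le> k"
        using sum n by linarith
      then show ?thesis
      proof cases
        case 1
        then obtain i' j' where "i = Suc i'" "j = Suc j'"
          by (auto simp: Suc_le_eq gr0_conv_Suc)
        with 1 sum show ?thesis unfolding p
          by (intro bexI[of _ "(i', j', k + 2)"] bexI[of _ "(Suc i', j', k + 1)"]
              bexI[of _ "(i', Suc j', k + 1)"]) (auto simp: T_iff btw_def min_absorb1 min_absorb2)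
      next
        case 2
        then obtain j' k' where "j = Suc j'" "k = Suc k'"
          by (auto simp: Suc_le_eq gr0_conv_Suc)
        with 2 sum show ?thesis unfolding p
          by (intro bexI[of _ "(i + 2, j', k')"] bexI[of _ "(i + 1, Suc j', k')"]
              bexI[of _ "(i + 1, j', Suc k')"]) (auto simp: T_iff btw_def min_absorb1 min_absorb2)
      next
        case 3
        then obtain i' k' where "i = Suc i'" "k = Suc k'"
          by (auto simp: Suc_le_eq gr0_conv_Suc)
        with 3 sum show ?thesis unfolding p
          by (intro bexI[of _ "(i', j + 2, k')"] bexI[of _ "(Suc i', j + 1, k')"]
              bexI[of _ "(i', j + 1, Suc k')"]) (auto simp: T_iff btw_def min_absorb1 min_absorb2)
      next
        case 4
        then obtain i' where "i = Suc (Suc i')" by (auto simp: nat_le_iff_add)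
        with 4 sum show ?thesis unfolding p
          by (intro bexI[of _ "(i', 1, 1)"] bexI[of _ "(i', 2, 0)"]
              bexI[of _ "(Suc i', 1, 0)"]) (auto simp: T_iff btw_def min_absorb1 min_absorb2)
      next
        case 5
        then obtain j' where "j = Suc (Suc j')" by (auto simp: nat_le_iff_add)
        with 5 sum show ?thesis unfolding p
          by (intro bexI[of _ "(1, j', 1)"] bexI[of _ "(2, j', 0)"]
              bexI[of _ "(1, Suc j', 0)"]) (auto simp: T_iff btw_def min_absorb1 min_absorb2)
      next
        case 6
        then obtain k' where "k = Suc (Suc k')" by (auto simp: nat_le_iff_add)
        with 6 sum show ?thesis unfolding p
          by (intro bexI[of _ "(1, 1, k')"] bexI[of _ "(2, 0, k')"]
              bexI[of _ "(1, 0, Suc k')"]) (auto simp: T_iff btw_def min_absorb1 min_absorb2)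
      qed
    qed
  qed
qed

text \<open>
  Here \<open>t (i, j, k) = (va)\<^sup>i(vb)\<^sup>j(vc)\<^sup>k\<close> has the constant exponent \<open>2\<close> at \<open>v\<close>, so divisibility is that of
  the monomials of degree \<open>2\<close> in \<open>a\<close>, \<open>b\<close>, \<open>c\<close>.  For \<open>x = a\<^sup>2\<close> take \<open>z = b\<^sup>2\<close> and \<open>y = ab\<close>; for \<open>x = ab\<close>
  take \<open>z = c\<^sup>2\<close> and \<open>y = ac\<close>, where only \<open>y\<close> and \<open>z\<close> divide \<open>lcm(y, z) = ac\<^sup>2\<close>.
\<close>

lemma obstructed_claw:
  assumes E: "\<forall>e\<in>E. card e = 2" and dist: "distinct [v, a, b, c]"
    and edges: "{v, a} \<in> E" "{v, b} \<in> E" "{v, c} \<in> E"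
    and non_edges: "{a, b} \<notin> E" "{b, c} \<notin> E" "{c, a} \<notin> E"
  shows "obstructed (edge_products E 2)"
proof -
  define t where "t = (\<lambda>(i, j, k). repeat_mset i {#v, a#} + repeat_mset j {#v, b#} +
                         repeat_mset k {#v, c#})"
  define T :: "(nat \<times> nat \<times> nat) set" where
    "T = {(2, 0, 0), (0, 2, 0), (0, 0, 2), (1, 1, 0), (1, 0, 1), (0, 1, 1)}"
  define btw where "btw = (\<lambda>(i :: nat, j :: nat, k :: nat) (i', j', k') (i'', j'', k'').
      i \<le> max i' i'' \<and> j \<le> max j' j'' \<and> k \<le> max k' k'')"
  have T_iff: "(i, j, k) \<in> T \<longleftrightarrow> i + j + k = 2" for i j k
    unfolding T_def by (simp, presburger)
  have neq: "v \<noteq> a" "v \<noteq> b" "v \<noteq> c" "a \<noteq> b" "a \<noteq> c" "b \<noteq> c" using dist by auto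
  have count: "count (t (i, j, k)) a = i" "count (t (i, j, k)) b = j" "count (t (i, j, k)) c = k"
    "count (t (i, j, k)) v = i + j + k"
    "u \<noteq> v \<Longrightarrow> u \<noteq> a \<Longrightarrow> u \<noteq> b \<Longrightarrow> u \<noteq> c \<Longrightarrow> count (t (i, j, k)) u = 0" for i j k u
    using neq by (simp_all add: t_def)
  have set: "set_mset (t p) \<subseteq> {v, a, b, c}" for p
    by (auto simp: t_def split: prod.splits)
  show ?thesis
  proof (rule obstructedI[of T t _ btw])
    show "finite T" "T \<noteq> {}" by (auto simp: T_def)
    show "t p \<in> edge_products E 2" if "p \<in> T" for p
    proof -
      obtain i j k where p: "p = (i, j, k)" by (cases p)
      then have sum: "2 = i + j + k" using that by (simp add: T_iff)
      have "repeat_mset i {#v, a#} \<in> edge_products E i"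
        using edge_products_add_repeat[of "{#}" E 0 v a i] edges by simp
      from edge_products_add_repeat[OF edge_products_add_repeat[OF this edges(2)] edges(3)]
      show ?thesis unfolding sum by (simp add: p t_def)
    qed
    show "inj_on t T"
    proof (rule inj_onI)
      fix p q assume "t p = t q"
      then show "p = q" by (cases p; cases q) (metis count(1-3))
    qed
    show "w \<in> t ` T" if "p \<in> T" "q \<in> T" and w: "w \<in> edge_products E 2" "w \<subseteq># t p \<union># t q"
      for p q w
    proof -
      have "set_mset w \<subseteq> {v, a, b, c}" using set_mset_dvd_lcm[OF w(2)] set by blast
      then have "w \<in> edge_products {{v, a}, {v, b}, {v, c}} 2"
        by (rule edge_products_within[OF w(1) _ E]) (use non_edges in \<open>auto simp: insert_commute\<close>)
      then obtain i j k where "w = t (i, j, k)" "i + j + k = 2"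
        by (auto simp: edge_products_insert edge_products_empty t_def ac_simps
            simp del: repeat_mset_distrib_add_mset split: if_splits)
      then show ?thesis by (auto simp: T_iff)
    qed
    show "t s \<subseteq># t p \<union># t q \<longleftrightarrow> btw s p q" if "s \<in> T" "p \<in> T" "q \<in> T" for s p q
    proof -
      obtain i j k i' j' k' i'' j'' k'' where
        spq: "s = (i, j, k)" "p = (i', j', k')" "q = (i'', j'', k'')"
        by (cases s; cases p; cases q)
      then have n: "i + j + k = 2" "i' + j' + k' = 2" "i'' + j'' + k'' = 2"
        using that by (auto simp: T_iff)
      show ?thesis
        using n by (simp add: subseteq_mset_iff_on[OF set] spq count btw_def)
    qed
    show "\<exists>z\<in>T. \<exists>y\<^sub>1\<in>T. \<exists>y\<^sub>2\<in>T. p \<noteq> z \<and> {y\<^sub>1, y\<^sub>2} \<inter> {p, z} = {} \<and> btw y\<^sub>1 p z \<and> btw y\<^sub>2 p z \<and>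
        (\<forall>s\<in>T. btw s y\<^sub>1 z \<or> btw s y\<^sub>2 z \<longrightarrow> s \<in> {z, y\<^sub>1, y\<^sub>2})" if p: "p \<in> T" for p
    proof -
      consider "p = (2, 0, 0)" | "p = (0, 2, 0)" | "p = (0, 0, 2)"
        | "p = (1, 1, 0)" | "p = (1, 0, 1)" | "p = (0, 1, 1)"
        using p unfolding T_def by blast
      then show ?thesis
      proof cases
        case 1
        then show ?thesis
          by (intro bexI[of _ "(0, 2, 0)"] bexI[of _ "(1, 1, 0)"]) (auto simp: T_def btw_def)
      next
        case 2
        then show ?thesis
          by (intro bexI[of _ "(0, 0, 2)"] bexI[of _ "(0, 1, 1)"]) (auto simp: T_def btw_def)
      next
        case 3
        then show ?thesis
          by (intro bexI[of _ "(2, 0, 0)"] bexI[of _ "(1, 0, 1)"]) (auto simp: T_def btw_def)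
      next
        case 4
        then show ?thesis
          by (intro bexI[of _ "(0, 0, 2)"] bexI[of _ "(1, 0, 1)"]) (auto simp: T_def btw_def)
      next
        case 5
        then show ?thesis
          by (intro bexI[of _ "(0, 2, 0)"] bexI[of _ "(1, 1, 0)"]) (auto simp: T_def btw_def)
      next
        case 6
        then show ?thesis
          by (intro bexI[of _ "(2, 0, 0)"] bexI[of _ "(1, 1, 0)"]) (auto simp: T_def btw_def)
      qed
    qed
  qed
qed

text \<open>
  The four products \<open>t (i, k) = (ab)\<^sup>i(bc)\<^sup>n\<^sup>-\<^sup>i\<^sup>-\<^sup>k(cd)\<^sup>k\<close> with \<open>i, k \<le> 1\<close> form a square: the lcm of two
  opposite corners is divisible by all four, while the lcm of two adjacent corners is divisible by
  these two only.  So \<open>z\<close> is the corner opposite to \<open>x\<close>, and \<open>y\<^sub>1 = y\<^sub>2\<close> is adjacent to both.  The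
  edge \<open>da\<close> may be present: since the exponents of \<open>a\<close> and \<open>d\<close> are at most \<open>1\<close>, it can only
  contribute \<open>(da)(bc)\<^sup>n\<^sup>-\<^sup>1\<close>, which is \<open>t (1, 1)\<close>.
\<close>

lemma obstructed_three_edge_path:
  assumes E: "\<forall>e\<in>E. card e = 2" and dist: "distinct [a, b, c, d]"
    and edges: "{a, b} \<in> E" "{b, c} \<in> E" "{c, d} \<in> E"
    and non_edges: "{a, c} \<notin> E" "{b, d} \<notin> E" and n: "2 \<le> n"
  shows "obstructed (edge_products E n)"
proof -
  define t where "t = (\<lambda>(i, k). repeat_mset i {#a, b#} + repeat_mset (n - i - k) {#b, c#} +
                         repeat_mset k {#c, d#})"
  define T :: "(nat \<times> nat) set" where "T = {(0, 0), (0, 1), (1, 0), (1, 1)}"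
  define btw where "btw = (\<lambda>(i :: nat, k :: nat) (i', k') (i'', k'').
      min i' i'' \<le> i \<and> i \<le> max i' i'' \<and> min k' k'' \<le> k \<and> k \<le> max k' k'')"
  have T_iff: "(i, k) \<in> T \<longleftrightarrow> i \<le> 1 \<and> k \<le> 1" for i k
    unfolding T_def by auto
  have neq: "a \<noteq> b" "a \<noteq> c" "a \<noteq> d" "b \<noteq> c" "b \<noteq> d" "c \<noteq> d" using dist by auto
  have count: "count (t (i, k)) a = i" "count (t (i, k)) b = i + (n - i - k)"
    "count (t (i, k)) c = (n - i - k) + k" "count (t (i, k)) d = k"
    "u \<noteq> a \<Longrightarrow> u \<noteq> b \<Longrightarrow> u \<noteq> c \<Longrightarrow> u \<noteq> d \<Longrightarrow> count (t (i, k)) u = 0" for i k u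
    using neq by (simp_all add: t_def)
  have set: "set_mset (t p) \<subseteq> {a, b, c, d}" for p
    by (auto simp: t_def split: prod.splits)
  show ?thesis
  proof (rule obstructedI[of T t _ btw])
    show "finite T" "T \<noteq> {}" by (auto simp: T_def)
    show "t p \<in> edge_products E n" if "p \<in> T" for p
    proof -
      obtain i k where p: "p = (i, k)" by (cases p)
      then have sum: "i + (n - i - k) + k = n" using that n by (simp add: T_iff)
      have "repeat_mset i {#a, b#} \<in> edge_products E i"
        using edge_products_add_repeat[of "{#}" E 0 a b i] edges by simp
      from edge_products_add_repeat[OF edge_products_add_repeat[OF this edges(2), of "n - i - k"]
          edges(3), of k]
      show ?thesis unfolding sum by (simp add: p t_def)
    qed
    show "inj_on t T"
    proof (rule inj_onI)
      fix p q assume "t p = t q"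
      then show "p = q" by (cases p; cases q) (metis count(1,4))
    qed
    show "w \<in> t ` T" if pq: "p \<in> T" "q \<in> T" and w: "w \<in> edge_products E n" "w \<subseteq># t p \<union># t q"
      for p q w
    proof -
      have "set_mset w \<subseteq> {a, b, c, d}" using set_mset_dvd_lcm[OF w(2)] set by blast
      then have "w \<in> edge_products {{a, b}, {b, c}, {c, d}, {d, a}} n"
        by (rule edge_products_within[OF w(1) _ E]) (use non_edges in \<open>auto simp: insert_commute\<close>)
      then obtain i j k l where ijkl: "w = repeat_mset i {#a, b#} + repeat_mset j {#b, c#} +
            repeat_mset k {#c, d#} + repeat_mset l {#d, a#}" "i + j + k + l = n"
        by (auto simp: edge_products_insert edge_products_empty ac_simps
            simp del: repeat_mset_distrib_add_mset split: if_splits)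
      obtain i' k' i'' k'' where "p = (i', k')" "q = (i'', k'')" by (cases p; cases q)
      then have "i + l \<le> 1" "k + l \<le> 1"
        using mset_subset_eq_count[OF w(2), of a] mset_subset_eq_count[OF w(2), of d] pq dist
        by (auto simp: count T_iff ijkl(1))
      show ?thesis
      proof (cases "l = 0")
        case True
        then have "w = t (i, k)" using ijkl by (auto simp: t_def)
        then show ?thesis using \<open>i + l \<le> 1\<close> \<open>k + l \<le> 1\<close> by (auto simp: T_iff)
      next
        case False
        (* The edge da is used once: (da)(bc) = (ab)(cd). *)
        then have "l = 1" "i = 0" "k = 0" using \<open>i + l \<le> 1\<close> \<open>k + l \<le> 1\<close> by auto
        moreover have "j = Suc (n - 2)" using calculation ijkl(2) n by linarith
        ultimately have "w = t (1, 1)"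
          unfolding ijkl(1) by (simp add: t_def numeral_2_eq_2)
        then show ?thesis by (auto simp: T_iff)
      qed
    qed
    show "t s \<subseteq># t p \<union># t q \<longleftrightarrow> btw s p q" if "s \<in> T" "p \<in> T" "q \<in> T" for s p q
    proof -
      obtain i k i' k' i'' k'' where spq: "s = (i, k)" "p = (i', k')" "q = (i'', k'')"
        by (cases s; cases p; cases q)
      then have le1: "i \<le> 1" "i' \<le> 1" "i'' \<le> 1" "k \<le> 1" "k' \<le> 1" "k'' \<le> 1"
        using that by (auto simp: T_iff)
      have eqs: "j + (n - j - l) = n - l" "n - j - l + l = n - j" if "j \<le> 1" "l \<le> 1" for j l
        using that n by auto
      have le_iff: "n - x \<le> max (n - x') (n - x'') \<longleftrightarrow> min x' x'' \<le> x"
        if "x \<le> 1" "x' \<le> 1" "x'' \<le> 1" for x x' x''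
        using that n by (auto simp: le_max_iff_disj min_le_iff_disj)
      show ?thesis
        using le1 by (simp add: subseteq_mset_iff_on[OF set] spq count btw_def eqs le_iff conj_ac
            del: diff_diff_left)
    qed
    show "\<exists>z\<in>T. \<exists>y\<^sub>1\<in>T. \<exists>y\<^sub>2\<in>T. p \<noteq> z \<and> {y\<^sub>1, y\<^sub>2} \<inter> {p, z} = {} \<and> btw y\<^sub>1 p z \<and> btw y\<^sub>2 p z \<and>
        (\<forall>s\<in>T. btw s y\<^sub>1 z \<or> btw s y\<^sub>2 z \<longrightarrow> s \<in> {z, y\<^sub>1, y\<^sub>2})" if "p \<in> T" for p
    proof -
      obtain i k where p: "p = (i, k)" by (cases p)
      then have "i = 0 \<or> i = 1" "k = 0 \<or> k = 1" using that by (auto simp: T_iff)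
      then show ?thesis unfolding p
        by (intro bexI[of _ "(1 - i, 1 - k)"] bexI[of _ "(i, 1 - k)"]) (auto simp: T_def btw_def)
    qed
  qed
qed

section \<open>Connected graphs\<close>

text \<open>
  A triangle is an obstruction by itself.  Otherwise two adjacent edges form an induced path, which
  settles \<open>n \<ge> 3\<close>.  If \<open>n = 2\<close>, the graph has a vertex outside the path joined to it by an edge:
  at the middle vertex this gives a claw, at an end a path with three edges.
\<close>

lemma obstructed_connected_graph:
  assumes G: "finite_simple_graph V E" and conn: "connected_graph V E" and E0: "E \<noteq> {}"
    and n: "2 \<le> n" and not_edge: "\<not> is_edge_graph V E"
    and not_path: "\<not> (n = 2 \<and> is_path2_graph V E)"
  shows "obstructed (edge_products E n)"
proof -
  have E: "\<forall>e\<in>E. card e = 2" and EV: "\<And>x y. {x, y} \<in> E \<Longrightarrow> x \<in> V \<and> y \<in> V"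
    and ne: "\<And>x y. {x, y} \<in> E \<Longrightarrow> x \<noteq> y"
    using G by (auto simp: finite_simple_graph_def)
  have sub: "\<And>e. e \<in> E \<Longrightarrow> e \<subseteq> V" using G by (simp add: finite_simple_graph_def)
  have exit: "\<exists>x\<in>S. \<exists>y\<in>V - S. {x, y} \<in> E" if S: "s \<in> S" "S \<subset> V" for s S
  proof (rule ccontr)
    assume no: "\<not> ?thesis"
    obtain w where w: "w \<in> V" "w \<notin> S" using S(2) by blast
    have "(s, w) \<in> {(x, y). {x, y} \<in> E}\<^sup>*"
      using conn S w(1) by (auto simp: connected_graph_def)
    then have "w \<in> S"
    proof induction
      case base
      show ?case by (rule S(1))
    next
      case (step y z)
      then show ?case using no EV by blast
    qed
    with w(2) show False by contradiction
  qed
  show ?thesis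
  proof (cases "\<exists>a b c. {a, b} \<in> E \<and> {b, c} \<in> E \<and> {c, a} \<in> E")
    case True
    then obtain a b c where abc: "{a, b} \<in> E" "{b, c} \<in> E" "{c, a} \<in> E" by blast
    moreover have "distinct [a, b, c]" using ne abc by auto
    ultimately show ?thesis using obstructed_triangle[OF E _ _ _ _ n] by blast
  next
    case False
    then have triangle_free: "\<And>x y z. {x, y} \<in> E \<Longrightarrow> {y, z} \<in> E \<Longrightarrow> {x, z} \<notin> E"
      by (metis insert_commute)
    obtain e where "e \<in> E" using E0 by blast
    then obtain x y where xy: "{x, y} \<in> E" "x \<noteq> y"
      using E by (metis card_2_iff)
    have "\<exists>a b c. distinct [a, b, c] \<and> {a, b} \<in> E \<and> {b, c} \<in> E"
    proof (cases "V = {x, y}")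
      case True
      have "e = {x, y}" if "e \<in> E" for e
      proof (rule card_seteq)
        show "e \<subseteq> {x, y}" using sub[OF that] True by simp
        show "card {x, y} \<le> card e" using E that xy(2) by simp
      qed simp
      then have "E = {{x, y}}" using xy(1) by blast
      then show ?thesis using True xy(2) not_edge by (auto simp: is_edge_graph_def)
    next
      case False
      then have "{x, y} \<subset> V" using EV[OF xy(1)] by blast
      then obtain u w where "u \<in> {x, y}" "w \<in> V - {x, y}" "{u, w} \<in> E" using exit[of x "{x, y}"] by blast
      then consider "{x, w} \<in> E" "w \<noteq> x" "w \<noteq> y" | "{y, w} \<in> E" "w \<noteq> x" "w \<noteq> y" by auto
      then show ?thesis
      proof cases
        case 1
        then have "distinct [y, x, w] \<and> {y, x} \<in> E \<and> {x, w} \<in> E"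
          using xy by (auto simp: insert_commute)
        then show ?thesis by blast
      next
        case 2
        then have "distinct [x, y, w] \<and> {x, y} \<in> E \<and> {y, w} \<in> E" using xy by auto
        then show ?thesis by blast
      qed
    qed
    then obtain a b c where abc: "distinct [a, b, c]" "{a, b} \<in> E" "{b, c} \<in> E" by blast
    have ac: "{a, c} \<notin> E" by (rule triangle_free[OF abc(2,3)])
    show ?thesis
    proof (cases "n = 2")
      case False
      then have "3 \<le> n" using n by simp
      then show ?thesis by (rule obstructed_two_edge_path[OF E abc ac])
    next
      case True
      have "V \<noteq> {a, b, c}"
      proof
        assume V: "V = {a, b, c}"
        have "E = {{a, b}, {b, c}}"
        proof
          show "E \<subseteq> {{a, b}, {b, c}}"
          proof
            fix e assume e: "e \<in> E"
            obtain x y where "x \<in> V" "y \<in> V" "x \<noteq> y" "e = {x, y}"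
              by (rule edges_within[OF E e sub[OF e]])
            then show "e \<in> {{a, b}, {b, c}}" using ac e by (auto simp: V insert_commute)
          qed
        qed (use abc in auto)
        then show False using abc(1) V True not_path unfolding is_path2_graph_def by blast
      qed
      then have "{a, b, c} \<subset> V" using EV abc by blast
      then obtain u d where u: "u \<in> {a, b, c}" and d: "d \<in> V - {a, b, c}" "{u, d} \<in> E"
        using exit[of a "{a, b, c}"] by blast
      then consider "{d, a} \<in> E" | "{b, d} \<in> E" | "{c, d} \<in> E" by (auto simp: insert_commute)
      then show ?thesis
      proof cases
        case 1
        have "{d, b} \<notin> E" by (rule triangle_free[OF 1 abc(2)])
        then show ?thesis
          using obstructed_three_edge_path[OF E _ 1 abc(2,3) _ ac n] abc(1) d(1) by auto
      next
        case 2
        have ba: "{b, a} \<in> E" using abc(2) by (simp add: insert_commute)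
        have "{a, d} \<notin> E" "{c, d} \<notin> E"
          using triangle_free[OF abc(2) 2] triangle_free[of c b d] abc(3) 2
          by (simp_all add: insert_commute)
        then show ?thesis
          using obstructed_claw[OF E _ ba abc(3) 2 ac] abc(1) d(1) True
          by (auto simp: insert_commute)
      next
        case 3
        have "{b, d} \<notin> E" by (rule triangle_free[OF abc(3) 3])
        then show ?thesis
          using obstructed_three_edge_path[OF E _ abc(2,3) 3 ac _ n] abc(1) d(1) by auto
      qed
    qed
  qed
qed

text \<open>
  Distinct monomials of equal positive degree do not divide each other, so neither of two is redundant.
\<close>

lemma Sup_diff_neq_of_card_le_2:
  assumes "m \<in> \<sigma>" "\<sigma> \<subseteq> {u, w}" "size u = d" "size w = d" "(0::nat) < d"
  shows "Sup (\<sigma> - {m}) \<noteq> Sup (\<sigma> :: 'a multiset set)"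
proof
  assume eq: "Sup (\<sigma> - {m}) = Sup \<sigma>"
  have fin: "finite \<sigma>" using assms(2) finite_subset by blast
  have m: "m \<subseteq># Sup \<sigma>"
    by (rule subset_mset.cSup_upper[OF assms(1) subset_mset.bdd_above_finite[OF fin]])
  have size_m: "size m = d" using assms by auto
  show False
  proof (cases "\<sigma> - {m} = {}")
    case True
    then have "Sup \<sigma> = {#}" using eq unfolding True Sup_multiset_empty by simp
    then show False using m size_m assms(5) by simp
  next
    case False
    then obtain m' where m': "m' \<in> \<sigma>" "m' \<noteq> m" by blast
    then have "\<sigma> - {m} = {m'}" "size m' = d" using assms(1-4) by auto
    then have "m \<subseteq># m'" using eq m by simp
    then show False using m'(2) size_m \<open>size m' = d\<close>
      by (metis mset_subset_size order_less_irrefl subset_mset.le_imp_less_or_eq)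
  qed
qed

theorem theorem3p10:
  fixes V :: "'v set" and E :: "'v set set" and n :: nat
  assumes "finite_simple_graph V E"
    and "connected_graph V E"
    and "E \<noteq> {}"
    and "n \<ge> 2"
  shows "lyubeznik_ideal V (ideal_power V (edge_ideal V E :: ('v, 'k::field) mpoly set) n) \<longleftrightarrow>
           is_edge_graph V E \<or> (n = 2 \<and> is_path2_graph V E)"
proof -
  define I :: "('v, 'k) mpoly set" where "I = ideal_power V (edge_ideal V E) n"
  have EV: "\<And>e. e \<in> E \<Longrightarrow> e \<subseteq> V" and finV: "finite V"
    using assms(1) by (simp_all add: finite_simple_graph_def)
  have supp: "\<And>m. m \<in> edge_products E n \<Longrightarrow> set_mset m \<subseteq> V"
    by (rule set_mset_edge_products[OF EV])
  have gens: "gens I = edge_products E n"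
  proof -
    have "I = monomial_ideal V (edge_products E n)"
      unfolding I_def by (rule ideal_power_edge_ideal) (rule EV)
    then show ?thesis
      using gens_monomial_ideal[of "edge_products E n" V "2 * n"] supp size_edge_products by blast
  qed
  have fin: "finite (gens I)" unfolding gens by (rule finite_edge_products[OF finV EV])
  have iff: "lyubeznik_ideal V I \<longleftrightarrow> (\<exists>r. linear_order_on (gens I) r \<and>
           (\<forall>\<sigma>. lyubeznik_critical I r \<sigma> \<longrightarrow> (\<forall>m\<in>\<sigma>. Sup (\<sigma> - {m}) \<noteq> Sup \<sigma>)))"
    using supp by (intro lyubeznik_ideal_iff fin) (simp add: gens)
  have "is_edge_graph V E \<or> (n = 2 \<and> is_path2_graph V E)" if "lyubeznik_ideal V I"
  proof (rule ccontr)
    assume "\<not> ?thesis"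
    then have "obstructed (gens I)"
      unfolding gens using assms by (intro obstructed_connected_graph) auto
    then show False
      using that obstructed_imp_redundant_critical unfolding iff by blast
  qed
  moreover have "lyubeznik_ideal V I" if edge: "is_edge_graph V E"
  proof -
    obtain a b where "E = {{a, b}}" using edge by (auto simp: is_edge_graph_def)
    then have gens1: "gens I = {repeat_mset n {#a, b#}}"
      unfolding gens using edge_products_insert[of _ a b "{}" n]
      by (auto simp: edge_products_empty split: if_splits)
    have "linear_order_on (gens I) {(repeat_mset n {#a, b#}, repeat_mset n {#a, b#})}"
      unfolding gens1
      by (auto simp: order_on_defs refl_on_def trans_def antisym_def total_on_def)
    moreover have "Sup (\<sigma> - {m}) \<noteq> Sup \<sigma>" if "lyubeznik_critical I r \<sigma>" "m \<in> \<sigma>" for \<sigma> m r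
    proof (rule Sup_diff_neq_of_card_le_2[OF that(2)])
      show "\<sigma> \<subseteq> {repeat_mset n {#a, b#}, repeat_mset n {#a, b#}}"
        using that gens1 by (auto simp: lyubeznik_critical_def)
      show "size (repeat_mset n {#a, b#}) = 2 * n" "size (repeat_mset n {#a, b#}) = 2 * n" "0 < 2 * n"
        using assms(4) by simp_all
    qed
    ultimately show ?thesis unfolding iff by blast
  qed
  moreover have "lyubeznik_ideal V I" if n2: "n = 2" and path: "is_path2_graph V E"
  proof -
    obtain a b c where abc: "distinct [a, b, c]" and E: "E = {{a, b}, {b, c}}"
      using path by (auto simp: is_path2_graph_def)
    define u v w where "u = {#a, b#} + {#a, b#}" and "v = {#a, b#} + {#b, c#}" and "w = {#b, c#} + {#b, c#}"
    have gens3: "gens I = {u, v, w}"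
    proof -
      have P2: "edge_products E 2 = {p + {#x, y#} | p x y. p \<in> edge_products E 1 \<and> {x, y} \<in> E}"
        by (simp only: numeral_2_eq_2 One_nat_def edge_products.simps)
      have P1: "edge_products E 1 = {{#a, b#}, {#b, c#}}"
        by (auto simp: E doubleton_eq_iff)
      have "edge_products E 2 \<subseteq> {u, v, w}"
        unfolding P2 P1 by (auto simp: E u_def v_def w_def doubleton_eq_iff)
      moreover have "{u, v, w} \<subseteq> edge_products E 2"
        unfolding P2 P1 u_def v_def w_def unfolding E by blast
      ultimately show ?thesis unfolding gens n2 by blast
    qed
    have "count u a = 2" "count v a = 1" "count w a = 0"
      using abc by (auto simp: u_def v_def w_def)
    then have uvw: "u \<noteq> v" "v \<noteq> w" "u \<noteq> w" by auto
    have sizes: "size u = 4" "size v = 4" "size w = 4" by (simp_all add: u_def v_def w_def)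
    have vdiv: "v \<subseteq># u \<union># w"
      using abc unfolding u_def v_def w_def by (auto simp: subseteq_mset_def)
    (* The middle generator v is the smallest, so {u, w} is not critical. *)
    define r where "r = {(u, u), (v, v), (w, w), (u, w), (u, v), (w, v)}"
    have "linear_order_on (gens I) r"
      unfolding gens3 r_def using uvw
      by (auto simp: order_on_defs refl_on_def trans_def antisym_def total_on_def)
    moreover have "Sup (\<sigma> - {m}) \<noteq> Sup \<sigma>" if crit: "lyubeznik_critical I r \<sigma>" and m: "m \<in> \<sigma>" for \<sigma> m
    proof -
      have \<sigma>: "\<sigma> \<subseteq> {u, v, w}" using crit gens3 by (simp add: lyubeznik_critical_def)
      have "\<not> (u \<in> \<sigma> \<and> w \<in> \<sigma>)"
      proof
        assume uw: "u \<in> \<sigma> \<and> w \<in> \<sigma>"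
        then have eq: "{x \<in> \<sigma>. (x, w) \<in> r} = {u, w}" using uvw by (auto simp: r_def)
        have "1 < card {x \<in> \<sigma>. (x, w) \<in> r}" unfolding eq using uvw by simp
        moreover have "v \<subseteq># Sup {x \<in> \<sigma>. (x, w) \<in> r}"
          unfolding eq using vdiv by (simp add: Sup_insert_mset Sup_multiset_empty)
        moreover have "v \<in> gens I" "(w, v) \<in> r" using gens3 by (auto simp: r_def)
        ultimately show False
          using crit uw uvw(2) unfolding lyubeznik_critical_def by blast
      qed
      then have "\<sigma> \<subseteq> {u, v} \<or> \<sigma> \<subseteq> {w, v}" using \<sigma> by blast
      then show ?thesis
        using Sup_diff_neq_of_card_le_2[OF m] sizes by (metis zero_less_numeral)
    qed
    ultimately show ?thesis unfolding iff by blast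
  qed
  ultimately show ?thesis unfolding I_def by blast
qed

end
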